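(* Let $K$ be a field, let $\mathcal{H}$ be a complete $s$-uniform $t$-partite hypergraph with $2\leq s\leq t$ on vertex set $\{x_1,\ldots,x_n\}$, $R=K[x_1,\ldots,x_n]$, and let $l\geq 1$. Then $R/I(\mathcal{H})$ is $l$-Cohen-Macaulay if and only if $\mathcal{H}$ is $1$-balanced and $l\leq t-s+2$. In particular, $R/I(\mathcal{H})$ is Cohen-Macaulay if and only if it is $2$-Cohen-Macaulay.
   Context: A complete $s$-uniform $t$-partite hypergraph has vertex set partitioned into nonempty sides $V_1,\ldots,V_t$, and its edges are exactly all $s$-element vertex subsets consisting of one vertex from each of $s$ distinct sides. It is $1$-balanced if every side has exactly one vertex. The edge ideal $I(\mathcal{H})=(\prod_{x\in e}x: e\in\mathcal{H})$ is the Stanley-Reisner ideal of $\Delta=\mathrm{Ind}(\mathcal{H})$, the complex of independent sets. For a simplicial complex $\Delta$ on vertex set $V$, $R/I_\Delta$ is $l$-Cohen-Macaulay if for every $W\subset V$ with $|W|<l$, $R/I_{\Delta_{V\setminus W}}$ is Cohen-Macaulay and $\dim\Delta=\dim\Delta_{V\setminus W}$, where $\Delta_S=\{F\in\Delta:F\subseteq S\}$. *)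

theory Defs
  imports Main "HOL-Library.Poly_Mapping" "HOL-Library.Disjoint_Sets" "HOL-Library.Extended_Nat"
begin

text \<open>Multivariate polynomial ring K[x_v : v in V] over a field, where the vertex set V is
  the (finite) universe of the type of vertices: polynomials are finitely supported maps
  from monomials (exponent vectors) to coefficients.\<close>

type_synonym ('v, 'k) mpoly = "('v \<Rightarrow>\<^sub>0 nat) \<Rightarrow>\<^sub>0 'k"

definition Var :: "'v \<Rightarrow> ('v, 'k::comm_ring_1) mpoly" where
  "Var v = Poly_Mapping.single (Poly_Mapping.single v 1) 1"

definition sqfree_monomial :: "'v set \<Rightarrow> ('v, 'k::comm_ring_1) mpoly" where
  "sqfree_monomial F = (\<Prod>v\<in>F. Var v)"

definition is_ideal :: "'a::comm_ring_1 set \<Rightarrow> bool" where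
  "is_ideal I \<longleftrightarrow> 0 \<in> I \<and> (\<forall>a\<in>I. \<forall>b\<in>I. a + b \<in> I) \<and> (\<forall>a\<in>I. \<forall>r. r * a \<in> I)"

definition ideal_gen :: "'a::comm_ring_1 set \<Rightarrow> 'a set" where
  "ideal_gen S = \<Inter>{I. is_ideal I \<and> S \<subseteq> I}"

definition is_prime_ideal :: "'a::comm_ring_1 set \<Rightarrow> bool" where
  "is_prime_ideal P \<longleftrightarrow> is_ideal P \<and> P \<noteq> UNIV \<and> (\<forall>a b. a * b \<in> P \<longrightarrow> a \<in> P \<or> b \<in> P)"

definition krull_dim_quot :: "'a::comm_ring_1 set \<Rightarrow> enat" where
  "krull_dim_quot I = Sup {enat n | n. \<exists>p :: nat \<Rightarrow> 'a set.
      (\<forall>i\<le>n. is_prime_ideal (p i) \<and> I \<subseteq> p i) \<and> (\<forall>i<n. p i \<subset> p (Suc i))}"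

definition regular_seq_quot :: "'a::comm_ring_1 set \<Rightarrow> 'a set \<Rightarrow> 'a list \<Rightarrow> bool" where
  "regular_seq_quot m I fs \<longleftrightarrow>
     set fs \<subseteq> m \<and>
     (\<forall>i<length fs. \<forall>g. fs ! i * g \<in> ideal_gen (I \<union> set (take i fs))
                         \<longrightarrow> g \<in> ideal_gen (I \<union> set (take i fs))) \<and>
     ideal_gen (I \<union> set fs) \<noteq> UNIV"

definition depth_quot :: "'a::comm_ring_1 set \<Rightarrow> 'a set \<Rightarrow> enat" where
  "depth_quot m I = Sup {enat (length fs) | fs. regular_seq_quot m I fs}"

definition max_ideal :: "('v, 'k::comm_ring_1) mpoly set" where
  "max_ideal = ideal_gen (range Var)"

definition cohen_macaulay :: "('v, 'k::field) mpoly set \<Rightarrow> bool" where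
  "cohen_macaulay I \<longleftrightarrow> depth_quot max_ideal I = krull_dim_quot I"

text \<open>A simplicial complex on the vertex set UNIV (finite) is a set of faces.\<close>
definition cdim :: "'v set set \<Rightarrow> int" where
  "cdim \<Delta> = int (Max (card ` \<Delta>)) - 1"

definition restrict_complex :: "'v set set \<Rightarrow> 'v set \<Rightarrow> 'v set set" where
  "restrict_complex \<Delta> S = {F \<in> \<Delta>. F \<subseteq> S}"

definition stanley_reisner_ideal :: "'v set set \<Rightarrow> ('v, 'k::field) mpoly set" where
  "stanley_reisner_ideal \<Delta> = ideal_gen {sqfree_monomial F | F. F \<notin> \<Delta>}"

definition l_cohen_macaulay :: "('k::field) itself \<Rightarrow> nat \<Rightarrow> ('v::finite) set set \<Rightarrow> bool" where
  "l_cohen_macaulay K l \<Delta> \<longleftrightarrow>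
     (\<forall>W. card W < l \<longrightarrow>
        cohen_macaulay (stanley_reisner_ideal (restrict_complex \<Delta> (UNIV - W)) :: ('v, 'k) mpoly set)
        \<and> cdim \<Delta> = cdim (restrict_complex \<Delta> (UNIV - W)))"

definition edge_ideal :: "'v set set \<Rightarrow> ('v, 'k::field) mpoly set" where
  "edge_ideal H = ideal_gen {sqfree_monomial e | e. e \<in> H}"

definition independence_complex :: "'v set set \<Rightarrow> 'v set set" where
  "independence_complex H = {F. \<forall>e\<in>H. \<not> e \<subseteq> F}"

definition complete_uniform_multipartite :: "('v::finite) set set \<Rightarrow> nat \<Rightarrow> 'v set set \<Rightarrow> bool" where
  "complete_uniform_multipartite P s H \<longleftrightarrow> partition_on UNIV P \<and>
     H = {e. card e = s \<and> (\<forall>A\<in>P. card (e \<inter> A) \<le> 1)}"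

definition one_balanced :: "'v set set \<Rightarrow> bool" where
  "one_balanced P \<longleftrightarrow> (\<forall>A\<in>P. card A = 1)"

end

theory Submission
  imports Defs
begin

text \<open>
  Contracting each side to a point shows that the independence complex always has cohomology in
  dimension \<open>s - 2\<close>. Since a regular sequence of length \<open>n\<close> makes Koszul cohomology vanish in degrees
  below \<open>n\<close>, the depth is at most \<open>s - 1\<close>. A union of \<open>s - 1\<close> sides is a face, so the dimension
  exceeds \<open>s - 1\<close> as soon as one side has two vertices, and the quotient is then not Cohen--Macaulay.

  If all sides are singletons, the complex is the \<open>(s - 2)\<close>-skeleton of a simplex, and deleting
  vertices again gives such a skeleton, of the same dimension as long as \<open>s - 1\<close> vertices remain. The
  first \<open>r\<close> elementary symmetric polynomials form a regular sequence on the skeleton with faces of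
  at most \<open>r\<close> vertices, by induction on the number of vertices: a vertex \<open>x\<close> splits the face ring into
  the face rings of its star and of its deletion.
\<close>

subsection \<open>Ideals and weakly regular sequences\<close>

text \<open>Elementary symmetric polynomials are chosen because they work over every field: over a
  finite field, linear forms need not contain a system of parameters. They are formed in all
  variables of the ring, so that one and the same sequence can be tested on the star and on the
  deletion. On the star the vertex \<open>x\<close> has to be moved past them in a regular sequence;
  such a reordering relies on the grading.

  Depth and dimension are suprema, so every equality also asks for an upper bound. Both upper bounds
  come from one counting argument: if all faces have at most D vertices, any D + 1 polynomials
  satisfy a nontrivial polynomial relation modulo the face ideal, and neither D + 1 strict
  inclusions of primes nor a regular sequence of length D + 1 tolerates such a relation.

  The constant t - s + 2: deleting W from t vertices leaves at least s - 1 of them exactly if |W| <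
  t - s + 2. It is at least 2 because s <= t, and this is the second claim.\<close>

lemma ideal_zero: "is_ideal I \<Longrightarrow> 0 \<in> I"
  by (simp add: is_ideal_def)

lemma ideal_add: "is_ideal I \<Longrightarrow> a \<in> I \<Longrightarrow> b \<in> I \<Longrightarrow> a + b \<in> I"
  by (simp add: is_ideal_def)

lemma ideal_mult: "is_ideal I \<Longrightarrow> a \<in> I \<Longrightarrow> r * a \<in> I"
  by (simp add: is_ideal_def)

lemma ideal_mult_right: "is_ideal I \<Longrightarrow> a \<in> I \<Longrightarrow> a * r \<in> I"
  by (metis ideal_mult mult.commute)

lemma ideal_uminus: "is_ideal I \<Longrightarrow> a \<in> I \<Longrightarrow> - a \<in> I"
  using ideal_mult[of I a "-1"] by simp

lemma ideal_diff: "is_ideal I \<Longrightarrow> a \<in> I \<Longrightarrow> b \<in> I \<Longrightarrow> a - b \<in> I"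
  using ideal_add[of I a "- b"] ideal_uminus by auto

lemma ideal_sum: "is_ideal I \<Longrightarrow> (\<And>i. i \<in> A \<Longrightarrow> g i \<in> I) \<Longrightarrow> sum g A \<in> I"
  by (induction A rule: infinite_finite_induct) (auto intro: ideal_zero ideal_add)

lemma ideal_cong:
  assumes "is_ideal I" "a - b \<in> I"
  shows "a \<in> I \<longleftrightarrow> b \<in> I"
  using ideal_add[OF assms(1,2), of b] ideal_diff[OF assms(1) _ assms(2), of a] by auto

lemma ideal_eq_UNIV: "is_ideal I \<Longrightarrow> 1 \<in> I \<Longrightarrow> I = UNIV"
  using ideal_mult_right[of I 1] by auto

lemma is_ideal_ideal_gen: "is_ideal (ideal_gen S)"
  unfolding ideal_gen_def is_ideal_def by blast

lemma ideal_gen_superset: "S \<subseteq> ideal_gen S"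
  unfolding ideal_gen_def by blast

lemma ideal_gen_least: "is_ideal I \<Longrightarrow> S \<subseteq> I \<Longrightarrow> ideal_gen S \<subseteq> I"
  unfolding ideal_gen_def by blast

lemma ideal_gen_mono: "S \<subseteq> T \<Longrightarrow> ideal_gen S \<subseteq> ideal_gen T"
  unfolding ideal_gen_def by blast

lemma ideal_gen_ideal: "is_ideal I \<Longrightarrow> ideal_gen I = I"
  by (simp add: ideal_gen_least ideal_gen_superset subset_antisym)

lemma ideal_gen_Un_ideal_gen: "ideal_gen (ideal_gen A \<union> B) = ideal_gen (A \<union> B)"
proof (rule subset_antisym)
  have "ideal_gen A \<subseteq> ideal_gen (A \<union> B)" by (rule ideal_gen_mono) auto
  moreover have "B \<subseteq> ideal_gen (A \<union> B)" using ideal_gen_superset[of "A \<union> B"] by blast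
  ultimately show "ideal_gen (ideal_gen A \<union> B) \<subseteq> ideal_gen (A \<union> B)"
    by (intro ideal_gen_least is_ideal_ideal_gen) auto
  show "ideal_gen (A \<union> B) \<subseteq> ideal_gen (ideal_gen A \<union> B)"
    by (intro ideal_gen_mono) (use ideal_gen_superset[of A] in blast)
qed

definition adjoin :: "'a::comm_ring_1 set \<Rightarrow> 'a \<Rightarrow> 'a set" where
  "adjoin J f = ideal_gen (insert f J)"

lemma is_ideal_adjoin [simp]: "is_ideal (adjoin J f)"
  by (simp add: adjoin_def is_ideal_ideal_gen)

lemma mem_adjoin_iff:
  assumes "is_ideal J"
  shows "g \<in> adjoin J f \<longleftrightarrow> (\<exists>r. g - f * r \<in> J)"
proof
  let ?I = "{g. \<exists>r. g - f * r \<in> J}"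
  have "is_ideal ?I"
    unfolding is_ideal_def
  proof (intro conjI ballI allI)
    show "0 \<in> ?I" using ideal_zero[OF assms] by (auto intro!: exI[of _ 0])
    show "a + b \<in> ?I" if ab: "a \<in> ?I" "b \<in> ?I" for a b
    proof -
      obtain r s where "a - f * r \<in> J" "b - f * s \<in> J" using ab by blast
      from ideal_add[OF assms this] have "a + b - f * (r + s) \<in> J" by (simp add: algebra_simps)
      then show ?thesis by blast
    qed
    show "c * a \<in> ?I" if a: "a \<in> ?I" for a c
    proof -
      obtain r where "a - f * r \<in> J" using a by blast
      from ideal_mult[OF assms this, of c] have "c * a - f * (c * r) \<in> J" by (simp add: algebra_simps)
      then show ?thesis by blast
    qed
  qed
  moreover have "insert f J \<subseteq> ?I"
    using ideal_zero[OF assms] by (auto intro: exI[of _ 0] exI[of _ 1])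
  ultimately show "g \<in> adjoin J f \<Longrightarrow> \<exists>r. g - f * r \<in> J"
    using ideal_gen_least[of ?I "insert f J"] unfolding adjoin_def by blast
  assume "\<exists>r. g - f * r \<in> J"
  then obtain r where r: "g - f * r \<in> J" by blast
  have "g - f * r \<in> adjoin J f" "f \<in> adjoin J f"
    using r ideal_gen_superset[of "insert f J"] by (auto simp: adjoin_def)
  then have "(g - f * r) + f * r \<in> adjoin J f"
    by (intro ideal_add ideal_mult_right) simp_all
  then show "g \<in> adjoin J f" by simp
qed

lemma subset_adjoin: "J \<subseteq> adjoin J f"
  using ideal_gen_superset[of "insert f J"] by (auto simp: adjoin_def)

lemma generator_in_adjoin [simp]: "f \<in> adjoin J f"
  using ideal_gen_superset[of "insert f J"] by (auto simp: adjoin_def)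

lemma adjoin_commute: "adjoin (adjoin J f) g = adjoin (adjoin J g) f"
proof -
  have "adjoin (adjoin J f) g = ideal_gen ({f, g} \<union> J)" for f g
    unfolding adjoin_def using ideal_gen_Un_ideal_gen[of "insert f J" "{g}"] by (simp add: insert_commute)
  then show ?thesis by (simp add: insert_commute)
qed

text \<open>Properness of the final ideal is left out, so colon ideals equal to the whole ring cause
  no exception. The recursion moves the first element into the ideal, which suits inductions with a
  varying \<open>J\<close>.\<close>

primrec weakly_regular :: "'a::comm_ring_1 set \<Rightarrow> 'a list \<Rightarrow> bool" where
  "weakly_regular J [] \<longleftrightarrow> True"
| "weakly_regular J (f # fs) \<longleftrightarrow>
     (\<forall>g. f * g \<in> J \<longrightarrow> g \<in> J) \<and> weakly_regular (adjoin J f) fs"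

lemma weakly_regular_append:
  "weakly_regular J (fs @ gs) \<longleftrightarrow> weakly_regular J fs \<and> weakly_regular (foldl adjoin J fs) gs"
  by (induction fs arbitrary: J) auto

lemma foldl_adjoin: "is_ideal J \<Longrightarrow> foldl adjoin J fs = ideal_gen (J \<union> set fs)"
proof (induction fs arbitrary: J)
  case Nil
  then show ?case by (simp add: ideal_gen_ideal)
next
  case (Cons f fs)
  then show ?case
    using ideal_gen_Un_ideal_gen[of "insert f J" "set fs"] by (simp add: adjoin_def is_ideal_ideal_gen)
qed

lemma regular_seq_quot_iff:
  assumes "is_ideal J"
  shows "regular_seq_quot m J fs \<longleftrightarrow>
    set fs \<subseteq> m \<and> weakly_regular J fs \<and> ideal_gen (J \<union> set fs) \<noteq> UNIV"
proof -
  have "(\<forall>i<length fs. \<forall>g. fs ! i * g \<in> ideal_gen (J \<union> set (take i fs))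
            \<longrightarrow> g \<in> ideal_gen (J \<union> set (take i fs))) \<longleftrightarrow> weakly_regular J fs"
    using assms
  proof (induction fs arbitrary: J)
    case Nil
    then show ?case by simp
  next
    case (Cons f fs)
    have "ideal_gen (J \<union> insert f S) = ideal_gen (adjoin J f \<union> S)" for S
      using ideal_gen_Un_ideal_gen[of "insert f J" S] by (simp add: adjoin_def)
    then show ?case
      using Cons by (simp add: All_less_Suc2 ideal_gen_ideal)
  qed
  then show ?thesis by (simp add: regular_seq_quot_def)
qed

text \<open>The exact sequence \<open>0 \<rightarrow> R/(J:x) \<rightarrow> R/J \<rightarrow> R/(J+x) \<rightarrow> 0\<close> stays exact modulo each
  element that is regular on the right-hand term.\<close>

lemma weakly_regular_exact:
  assumes "is_ideal J" "weakly_regular {g. x * g \<in> J} fs" "weakly_regular (adjoin J x) fs"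
  shows "weakly_regular J fs"
  using assms
proof (induction fs arbitrary: J)
  case Nil
  then show ?case by simp
next
  case (Cons f fs)
  let ?C = "{g. x * g \<in> J}"
  note J = Cons.prems(1)
  have C: "is_ideal ?C"
    using J unfolding is_ideal_def by (auto simp: distrib_left mult.left_commute)
  have reg: "g \<in> J" if "f * g \<in> J" for g
  proof -
    have "f * g \<in> adjoin J x" using that subset_adjoin by blast
    then have "g \<in> adjoin J x" using Cons.prems(3) by simp
    then obtain r where r: "g - x * r \<in> J" using J by (auto simp: mem_adjoin_iff)
    have "f * g - f * (g - x * r) \<in> J" by (intro ideal_diff ideal_mult J that r)
    then have "f * r \<in> ?C" by (simp add: algebra_simps)
    then have "r \<in> ?C" using Cons.prems(2) by auto
    then show ?thesis using ideal_cong[OF J r] by simp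
  qed
  have colon: "{g. x * g \<in> adjoin J f} = adjoin ?C f"
  proof (intro equalityI subsetI)
    fix g assume "g \<in> {g. x * g \<in> adjoin J f}"
    then obtain r where r: "x * g - f * r \<in> J" using J by (auto simp: mem_adjoin_iff)
    then have "- (x * g - f * r) \<in> adjoin J x"
      using subset_adjoin ideal_uminus[OF J] by blast
    moreover have "x * g \<in> adjoin J x" by (intro ideal_mult_right) simp_all
    ultimately have "x * g + - (x * g - f * r) \<in> adjoin J x" by (intro ideal_add) simp_all
    then have "r \<in> adjoin J x" using Cons.prems(3) by simp
    then obtain h where h: "r - x * h \<in> J" using J by (auto simp: mem_adjoin_iff)
    have "(x * g - f * r) + f * (r - x * h) \<in> J" by (intro ideal_add ideal_mult J r h)
    then have "g - f * h \<in> ?C" by (simp add: algebra_simps)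
    then show "g \<in> adjoin ?C f" using C by (auto simp: mem_adjoin_iff)
  next
    fix g assume "g \<in> adjoin ?C f"
    then obtain r where "x * (g - f * r) \<in> J" using C by (auto simp: mem_adjoin_iff)
    then have "x * g - f * (x * r) \<in> J" by (simp add: algebra_simps)
    then show "g \<in> {g. x * g \<in> adjoin J f}" using J by (auto simp: mem_adjoin_iff)
  qed
  have "weakly_regular (adjoin J f) fs"
    using Cons.prems(2,3)
    by (simp add: Cons.IH colon adjoin_commute)
  then show ?case using reg by simp
qed

text \<open>Exchanging neighbours in a regular sequence fails in general rings. Here an element
  killed by \<open>f\<close> modulo \<open>J\<close> can be divided by \<open>x\<close> again and
  again, so it lies in every \<open>adjoin J (x ^ k)\<close>, and the separation hypothesis puts it
  into \<open>J\<close>.\<close>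

lemma regular_swap:
  assumes J: "is_ideal J"
    and sep: "\<And>g. (\<And>k. g \<in> adjoin J (x ^ k)) \<Longrightarrow> g \<in> J"
    and x: "\<And>g. x * g \<in> J \<Longrightarrow> g \<in> J"
    and f: "\<And>g. f * g \<in> adjoin J x \<Longrightarrow> g \<in> adjoin J x"
  shows "f * g \<in> J \<Longrightarrow> g \<in> J"
    and "x * g \<in> adjoin J f \<Longrightarrow> g \<in> adjoin J f"
proof -
  assume fg: "f * g \<in> J"
  have "\<exists>h. g - x ^ k * h \<in> J \<and> f * h \<in> J" for k
  proof (induction k)
    case 0
    show ?case using fg ideal_zero[OF J] by (auto intro!: exI[of _ g])
  next
    case (Suc k)
    then obtain h where h: "g - x ^ k * h \<in> J" "f * h \<in> J" by blast
    then have "h \<in> adjoin J x" using f subset_adjoin by blast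
    then obtain r where r: "h - x * r \<in> J" using J by (auto simp: mem_adjoin_iff)
    have "f * h - f * (h - x * r) \<in> J" by (intro ideal_diff ideal_mult J h r)
    then have "x * (f * r) \<in> J" by (simp add: algebra_simps)
    then have "f * r \<in> J" by (rule x)
    moreover have "(g - x ^ k * h) + x ^ k * (h - x * r) \<in> J"
      by (intro ideal_add ideal_mult J h r)
    then have "g - x ^ Suc k * r \<in> J" by (simp add: algebra_simps)
    ultimately show ?case by blast
  qed
  then show "g \<in> J" by (intro sep) (use J in \<open>auto simp: mem_adjoin_iff\<close>)
next
  assume "x * g \<in> adjoin J f"
  then obtain r where r: "x * g - f * r \<in> J" using J by (auto simp: mem_adjoin_iff)
  then have "f * r - x * g \<in> J" using ideal_uminus[OF J r] by simp
  then have "f * r \<in> adjoin J x" using J by (auto simp: mem_adjoin_iff)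
  then have "r \<in> adjoin J x" by (rule f)
  then obtain s where s: "r - x * s \<in> J" using J by (auto simp: mem_adjoin_iff)
  have "(x * g - f * r) + f * (r - x * s) \<in> J" by (intro ideal_add ideal_mult J r s)
  then have "x * (g - f * s) \<in> J" by (simp add: algebra_simps)
  then have "g - f * s \<in> J" by (rule x)
  then show "g \<in> adjoin J f" using J by (auto simp: mem_adjoin_iff)
qed

subsection \<open>Algebraic dependence and chains of ideals\<close>

primrec power_product :: "'a::comm_ring_1 list \<Rightarrow> nat list \<Rightarrow> 'a" where
  "power_product [] a = 1"
| "power_product (f # fs) a = f ^ hd a * power_product fs (tl a)"

lemma regular_power:
  fixes f :: "'a::comm_ring_1"
  assumes "\<And>g. f * g \<in> J \<Longrightarrow> g \<in> J" "f ^ k * g \<in> J"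
  shows "g \<in> J"
  using assms(2)
proof (induction k)
  case (Suc k)
  have "f * (f ^ k * g) \<in> J" using Suc.prems by (simp add: mult.assoc)
  then show ?case using assms(1) Suc.IH by blast
qed simp

text \<open>Both strictly increasing chains of primes and regular sequences give rise to ideals
  \<open>J i\<close> and elements as below. Dividing a relation by the lowest power of the first element that
  occurs in it and then reducing modulo that element eliminates the elements one at a time
  (Coquand and Lombardi's description of Krull dimension).\<close>

lemma algebraic_dependence_chain:
  fixes J :: "nat \<Rightarrow> 'a::comm_ring_1 set"
  assumes "\<And>i. i \<le> length fs \<Longrightarrow> is_ideal (J i)"
    and "\<And>i. i < length fs \<Longrightarrow> J i \<subseteq> J (Suc i)"
    and "\<And>i. i < length fs \<Longrightarrow> fs ! i \<in> J (Suc i)"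
    and "\<And>i g. i < length fs \<Longrightarrow> fs ! i * g \<in> J i \<Longrightarrow> g \<in> J i"
    and "finite X" "\<And>a. a \<in> X \<Longrightarrow> length a = length fs"
    and "\<And>a. a \<in> X \<Longrightarrow> c a \<noteq> 0 \<Longrightarrow> c a dvd 1" "\<exists>a\<in>X. c a \<noteq> 0"
    and "(\<Sum>a\<in>X. c a * power_product fs a) \<in> J 0"
  shows "1 \<in> J (length fs)"
  using assms
proof (induction fs arbitrary: J X c)
  case Nil
  \<comment> \<open>The only exponent list is \<open>[]\<close>, so the relation says that a unit
    lies in \<open>J 0\<close>.\<close>
  have X: "X = {[]}" and c: "c [] \<noteq> 0" and J: "is_ideal (J 0)"
    using Nil.prems(1,6,8) by fastforce+
  then have "c [] \<in> J 0" "c [] dvd 1" using Nil.prems(7,9) by auto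
  then show ?case using ideal_mult_right[OF J] by (metis dvdE list.size(3))
next
  case (Cons f fs)
  have J0: "is_ideal (J 0)" and J1: "is_ideal (J 1)" using Cons.prems(1) by auto
  have J01: "J 0 \<subseteq> J 1" and f: "f \<in> J 1" and reg: "f * g \<in> J 0 \<Longrightarrow> g \<in> J 0" for g
    using Cons.prems(2)[of 0] Cons.prems(3)[of 0] Cons.prems(4)[of 0] by auto
  define X' where "X' = {a \<in> X. c a \<noteq> 0}"
  define k where "k = Min (hd ` X')"
  define Y where "Y = {a \<in> X'. hd a = k}"
  define Z where "Z = {a \<in> X'. hd a \<noteq> k}"
  have fin: "finite X'" "X' \<noteq> {}" using Cons.prems(5,8) by (auto simp: X'_def)
  have kle: "k \<le> hd a" if "a \<in> X'" for a using fin that by (auto simp: k_def)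
  have "k \<in> hd ` X'" using fin unfolding k_def by (intro Min_in) auto
  then have "Y \<noteq> {}" by (auto simp: Y_def)
  have cons: "\<exists>u b. a = u # b \<and> length b = length fs" if "a \<in> X'" for a
    using that Cons.prems(6)[of a] by (auto simp: X'_def length_Suc_conv)
  have YE: "a = k # tl a" if "a \<in> Y" for a using that cons[of a] by (auto simp: Y_def)
  have inj: "inj_on tl Y" by (rule inj_onI) (metis YE)
  \<comment> \<open>With \<open>f ^ k\<close> factored out, \<open>S\<close> collects the terms free
    of \<open>f\<close>, and \<open>f * T\<close> the others. As \<open>f\<close> lies in
    \<open>J 1\<close>, \<open>S\<close> is a relation among the remaining elements modulo
    \<open>J 1\<close>, with the coefficients it had before.\<close>
  define S where "S = (\<Sum>b\<in>tl ` Y. c (k # b) * power_product fs b)"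
  define T where "T = (\<Sum>a\<in>Z. c a * f ^ (hd a - k - 1) * power_product fs (tl a))"
  have "(\<Sum>a\<in>X. c a * power_product (f # fs) a) = (\<Sum>a\<in>X'. c a * power_product (f # fs) a)"
    using Cons.prems(5) by (intro sum.mono_neutral_right) (auto simp: X'_def)
  also have "\<dots> = (\<Sum>a\<in>Y. c a * power_product (f # fs) a) + (\<Sum>a\<in>Z. c a * power_product (f # fs) a)"
    using fin by (subst sum.union_disjoint[symmetric]) (auto simp: Y_def Z_def intro!: sum.cong)
  also have "(\<Sum>a\<in>Y. c a * power_product (f # fs) a) = f ^ k * S"
    unfolding S_def sum_distrib_left sum.reindex[OF inj] o_def
  proof (intro sum.cong refl)
    fix a assume "a \<in> Y"
    then obtain b where "a = k # b" using YE by blast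
    then show "c a * power_product (f # fs) a = f ^ k * (c (k # tl a) * power_product fs (tl a))"
      by (simp add: mult_ac)
  qed
  also have "(\<Sum>a\<in>Z. c a * power_product (f # fs) a) = f ^ k * (f * T)"
    unfolding T_def sum_distrib_left
  proof (intro sum.cong refl)
    fix a assume "a \<in> Z"
    then have "hd a = k + Suc (hd a - k - 1)" using kle[of a] by (auto simp: Z_def)
    then have "f ^ hd a = f ^ k * (f * f ^ (hd a - k - 1))" by (metis power_add power_Suc)
    then show "c a * power_product (f # fs) a =
        f ^ k * (f * (c a * f ^ (hd a - k - 1) * power_product fs (tl a)))"
      by (simp add: mult_ac)
  qed
  finally have "f ^ k * (S + f * T) \<in> J 0" using Cons.prems(9) by (simp add: distrib_left)
  then have "S + f * T \<in> J 1" using regular_power[OF reg] J01 by blast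
  then have S: "S \<in> J 1"
    using ideal_diff[OF J1 _ ideal_mult_right[OF J1 f], of "S + f * T" T] by simp
  have "1 \<in> J (Suc (length fs))"
  proof (rule Cons.IH[where J = "\<lambda>i. J (Suc i)" and X = "tl ` Y" and c = "\<lambda>b. c (k # b)"])
    show "finite (tl ` Y)" using fin by (simp add: Y_def)
    show "length b = length fs" if "b \<in> tl ` Y" for b using that cons by (force simp: Y_def)
    show "c (k # b) dvd 1" if "b \<in> tl ` Y" for b
    proof -
      have "k # b \<in> Y" using that YE by auto
      then show ?thesis using Cons.prems(7) by (auto simp: Y_def X'_def)
    qed
    show "\<exists>b\<in>tl ` Y. c (k # b) \<noteq> 0"
    proof -
      obtain a where "a \<in> Y" using \<open>Y \<noteq> {}\<close> by blast
      moreover from this have "c a \<noteq> 0" by (auto simp: Y_def X'_def)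
      ultimately show ?thesis using YE[of a] by (metis imageI)
    qed
    show "(\<Sum>b\<in>tl ` Y. c (k # b) * power_product fs b) \<in> J (Suc 0)"
      using S by (simp add: S_def)
  qed (use Cons.prems(1)[of "Suc _"] Cons.prems(2)[of "Suc _"] Cons.prems(3)[of "Suc _"]
        Cons.prems(4)[of "Suc _"] in auto)
  then show ?case by simp
qed

subsection \<open>Stanley--Reisner ideals\<close>

abbreviation "keys \<equiv> Poly_Mapping.keys"
abbreviation "lookup \<equiv> Poly_Mapping.lookup"
abbreviation "single \<equiv> Poly_Mapping.single"

text \<open>Natural exponents cannot cancel; hence whether the support of a product is a face
  depends only on the supports of its factors.\<close>

lemma keys_plus_nat: "keys (m + m') = keys m \<union> keys (m' :: 'v \<Rightarrow>\<^sub>0 nat)"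
  by (auto simp: in_keys_iff lookup_add)

lemma sum_monomials: "(\<Sum>m\<in>keys f. single m (lookup f m)) = f"
proof (rule poly_mapping_eqI)
  fix k
  show "lookup (\<Sum>m\<in>keys f. single m (lookup f m)) k = lookup f k"
    by (cases "k \<in> keys f")
      (auto simp: lookup_sum lookup_single when_def sum.delta' in_keys_iff)
qed

lemma lookup_single_mult:
  fixes f :: "('v, 'k::comm_ring_1) mpoly"
  shows "lookup (single a c * f) (a + m) = c * lookup f m"
  by (simp add: lookup_mult lookup_single when_mult)

lemma keys_single_mult: "keys (single a c * f) \<subseteq> (+) a ` keys (f :: ('v, 'k::comm_ring_1) mpoly)"
  using keys_mult[of "single a c" f] by (auto split: if_splits)

lemma keys_Var_mult: "keys (Var x * f) = (+) (single x 1) ` keys (f :: ('v, 'k::comm_ring_1) mpoly)"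
proof
  show "keys (Var x * f) \<subseteq> (+) (single x 1) ` keys f"
    unfolding Var_def by (rule keys_single_mult)
  show "(+) (single x 1) ` keys f \<subseteq> keys (Var x * f)"
    by (auto simp: Var_def in_keys_iff lookup_single_mult)
qed

definition indicator_monomial :: "'v set \<Rightarrow> 'v \<Rightarrow>\<^sub>0 nat" where
  "indicator_monomial F = (\<Sum>v\<in>F. single v 1)"

lemma lookup_indicator_monomial:
  "finite F \<Longrightarrow> lookup (indicator_monomial F) v = (if v \<in> F then 1 else 0)"
  by (simp add: indicator_monomial_def lookup_sum lookup_single when_def sum.delta')

lemma keys_indicator_monomial [simp]: "finite F \<Longrightarrow> keys (indicator_monomial F) = F"
  by (auto simp: in_keys_iff lookup_indicator_monomial split: if_splits)

lemma sqfree_monomial_conv_single: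
  "finite F \<Longrightarrow> sqfree_monomial F = single (indicator_monomial F) (1 :: 'k::comm_ring_1)"
proof (induction F rule: finite_induct)
  case empty
  then show ?case by (simp add: sqfree_monomial_def indicator_monomial_def)
next
  case (insert x F)
  then have "sqfree_monomial (insert x F) = Var x * (sqfree_monomial F :: ('a, 'k) mpoly)"
    by (simp add: sqfree_monomial_def)
  also have "\<dots> = single (indicator_monomial (insert x F)) 1"
    using insert by (simp add: Var_def mult_single indicator_monomial_def)
  finally show ?case .
qed

lemma sqfree_monomial_dvd_single:
  assumes "finite F" "F \<subseteq> keys m"
  shows "single m c = single (m - indicator_monomial F) c * sqfree_monomial F"
proof -
  have "lookup (indicator_monomial F) v \<le> lookup m v" for v
  proof (cases "v \<in> F")
    case True
    then have "lookup m v \<noteq> 0" using assms by (auto simp: in_keys_iff)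
    then show ?thesis using assms by (simp add: lookup_indicator_monomial)
  qed (simp add: assms lookup_indicator_monomial)
  then have "m - indicator_monomial F + indicator_monomial F = m"
    by (intro poly_mapping_eqI) (simp add: lookup_add lookup_minus)
  then show ?thesis using assms by (simp add: sqfree_monomial_conv_single mult_single)
qed

lemma sqfree_monomial_singleton [simp]: "sqfree_monomial {v} = Var v"
  by (simp add: sqfree_monomial_def)

lemma Var_dvd_single: "v \<in> keys m \<Longrightarrow> single m c = single (m - indicator_monomial {v}) c * Var v"
  using sqfree_monomial_dvd_single[of "{v}" m c] by simp

section \<open>Face ideals; stars and deletions as ideal operations\<close>

definition down_closed :: "'v set set \<Rightarrow> bool" where
  "down_closed \<Delta> \<longleftrightarrow> (\<forall>F\<in>\<Delta>. \<forall>G\<subseteq>F. G \<in> \<Delta>)"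

text \<open>For a complex this is the Stanley-Reisner ideal, given by a test on each monomial
  instead of generators. Inclusions and colon ideals then become statements about sets of
  faces.\<close>

definition face_ideal :: "'v set set \<Rightarrow> ('v, 'k::comm_ring_1) mpoly set" where
  "face_ideal \<Delta> = {f. \<forall>m\<in>keys f. keys m \<notin> \<Delta>}"

lemma is_ideal_face_ideal:
  assumes "down_closed \<Delta>"
  shows "is_ideal (face_ideal \<Delta>)"
  unfolding is_ideal_def
proof (intro conjI ballI allI)
  show "0 \<in> face_ideal \<Delta>" by (simp add: face_ideal_def)
  show "a + b \<in> face_ideal \<Delta>" if "a \<in> face_ideal \<Delta>" "b \<in> face_ideal \<Delta>" for a b :: "('a, 'b) mpoly"
    using that keys_add[of a b] by (auto simp: face_ideal_def)
  show "r * a \<in> face_ideal \<Delta>" if a: "a \<in> face_ideal \<Delta>" for a r :: "('a, 'b) mpoly"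
    unfolding face_ideal_def
  proof (intro CollectI ballI notI)
    fix m assume "m \<in> keys (r * a)" and m: "keys m \<in> \<Delta>"
    then obtain p q where "m = p + q" "q \<in> keys a" using keys_mult[of r a] by auto
    then show False using a m assms by (auto simp: face_ideal_def down_closed_def keys_plus_nat)
  qed
qed

lemma face_ideal_antimono: "\<Delta> \<subseteq> \<Gamma> \<Longrightarrow> face_ideal \<Gamma> \<subseteq> face_ideal \<Delta>"
  by (auto simp: face_ideal_def)

lemma mem_idealI_monomials:
  assumes "is_ideal I" "\<And>m. m \<in> keys f \<Longrightarrow> single m (lookup f m) \<in> I"
  shows "f \<in> I"
  using ideal_sum[OF assms(1), of "keys f" "\<lambda>m. single m (lookup f m)"] assms(2)
  by (simp add: sum_monomials)

lemma single_in_face_ideal: "keys m \<notin> \<Delta> \<Longrightarrow> single m c \<in> face_ideal \<Delta>"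
  by (auto simp: face_ideal_def)

lemma sqfree_monomial_in_face_ideal: "finite F \<Longrightarrow> F \<notin> \<Delta> \<Longrightarrow> sqfree_monomial F \<in> face_ideal \<Delta>"
  by (simp add: sqfree_monomial_conv_single single_in_face_ideal)

lemma mem_ideal_gen_sqfree_monomials:
  fixes f :: "('v::finite, 'k::comm_ring_1) mpoly"
  assumes "\<And>m. m \<in> keys f \<Longrightarrow> \<exists>F\<in>E. F \<subseteq> keys m"
  shows "f \<in> ideal_gen {sqfree_monomial F | F. F \<in> E}"
proof (rule mem_idealI_monomials[OF is_ideal_ideal_gen])
  let ?G = "{sqfree_monomial F | F. F \<in> E} :: ('v, 'k) mpoly set"
  fix m assume "m \<in> keys f"
  then obtain F where "F \<in> E" and F: "F \<subseteq> keys m" using assms by blast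
  then have "sqfree_monomial F \<in> ideal_gen ?G"
    using ideal_gen_superset[of ?G] by blast
  then show "single m (lookup f m) \<in> ideal_gen ?G"
    by (subst sqfree_monomial_dvd_single[OF finite F]) (rule ideal_mult[OF is_ideal_ideal_gen])
qed

lemma stanley_reisner_ideal_eq:
  fixes \<Delta> :: "'v::finite set set"
  assumes "down_closed \<Delta>"
  shows "stanley_reisner_ideal \<Delta> = (face_ideal \<Delta> :: ('v, 'k::field) mpoly set)"
proof
  show "stanley_reisner_ideal \<Delta> \<subseteq> (face_ideal \<Delta> :: ('v, 'k) mpoly set)"
    unfolding stanley_reisner_ideal_def
    using assms by (intro ideal_gen_least is_ideal_face_ideal) (auto intro: sqfree_monomial_in_face_ideal)
  show "(face_ideal \<Delta> :: ('v, 'k) mpoly set) \<subseteq> stanley_reisner_ideal \<Delta>"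
  proof
    fix f :: "('v, 'k) mpoly" assume "f \<in> face_ideal \<Delta>"
    then have "f \<in> ideal_gen {sqfree_monomial F | F. F \<in> - \<Delta>}"
      by (intro mem_ideal_gen_sqfree_monomials) (auto simp: face_ideal_def)
    then show "f \<in> stanley_reisner_ideal \<Delta>" by (simp add: stanley_reisner_ideal_def)
  qed
qed

lemma down_closed_independence_complex: "down_closed (independence_complex H)"
  by (auto simp: down_closed_def independence_complex_def)

lemma edge_ideal_eq:
  fixes H :: "'v::finite set set"
  shows "edge_ideal H = (face_ideal (independence_complex H) :: ('v, 'k::field) mpoly set)"
proof
  show "edge_ideal H \<subseteq> (face_ideal (independence_complex H) :: ('v, 'k) mpoly set)"
    unfolding edge_ideal_def
    by (intro ideal_gen_least is_ideal_face_ideal down_closed_independence_complex)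
      (auto intro!: sqfree_monomial_in_face_ideal simp: independence_complex_def)
  show "(face_ideal (independence_complex H) :: ('v, 'k) mpoly set) \<subseteq> edge_ideal H"
    unfolding edge_ideal_def
    by (intro subsetI mem_ideal_gen_sqfree_monomials) (auto simp: face_ideal_def independence_complex_def)
qed

text \<open>For a complex, the family on the right is the star of \<open>x\<close>, not its link, as
  \<open>F\<close> may contain \<open>x\<close>. So the colon ideal by a variable is again a face
  ideal.\<close>

lemma Var_mult_in_face_ideal_iff:
  "Var x * g \<in> face_ideal \<Delta> \<longleftrightarrow> g \<in> face_ideal {F. insert x F \<in> \<Delta>}"
  by (simp add: face_ideal_def keys_Var_mult keys_plus_nat)

lemma adjoin_Var_face_ideal:
  assumes "down_closed \<Delta>"
  shows "adjoin (face_ideal \<Delta>) (Var x) = face_ideal {F \<in> \<Delta>. x \<notin> F}"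
proof
  have "down_closed {F \<in> \<Delta>. x \<notin> F}" using assms by (auto simp: down_closed_def)
  then show "adjoin (face_ideal \<Delta>) (Var x) \<subseteq> face_ideal {F \<in> \<Delta>. x \<notin> F}"
    unfolding adjoin_def
    by (intro ideal_gen_least is_ideal_face_ideal) (auto simp: face_ideal_def Var_def)
  show "face_ideal {F \<in> \<Delta>. x \<notin> F} \<subseteq> adjoin (face_ideal \<Delta>) (Var x)"
  proof
    fix f assume f: "f \<in> face_ideal {F \<in> \<Delta>. x \<notin> F}"
    show "f \<in> adjoin (face_ideal \<Delta>) (Var x)"
    proof (rule mem_idealI_monomials[OF is_ideal_adjoin])
      fix m assume m: "m \<in> keys f"
      show "single m (lookup f m) \<in> adjoin (face_ideal \<Delta>) (Var x)"
      proof (cases "x \<in> keys m")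
        case True
        then show ?thesis by (simp add: Var_dvd_single ideal_mult)
      next
        case False
        then have "single m (lookup f m) \<in> face_ideal \<Delta>"
          using f m by (intro single_in_face_ideal) (auto simp: face_ideal_def)
        then show ?thesis using subset_adjoin by blast
      qed
    qed
  qed
qed

subsection \<open>Grading\<close>

definition total_degree :: "('v::finite \<Rightarrow>\<^sub>0 nat) \<Rightarrow> nat" where
  "total_degree m = (\<Sum>v\<in>UNIV. lookup m v)"

lemma total_degree_add: "total_degree (m + m') = total_degree m + total_degree m'"
  by (simp add: total_degree_def lookup_add sum.distrib)

definition homogeneous :: "nat \<Rightarrow> ('v::finite, 'k::comm_ring_1) mpoly \<Rightarrow> bool" where
  "homogeneous d f \<longleftrightarrow> (\<forall>m\<in>keys f. total_degree m = d)"

lemma homogeneous_mult: "homogeneous d f \<Longrightarrow> homogeneous e g \<Longrightarrow> homogeneous (d + e) (f * g)"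
  using keys_mult[of f g] by (fastforce simp: homogeneous_def total_degree_add)

lemma homogeneous_1: "homogeneous 0 1"
  by (simp add: homogeneous_def total_degree_def)

lemma homogeneous_power: "homogeneous d f \<Longrightarrow> homogeneous (d * n) (f ^ n)"
  by (induction n) (simp_all add: homogeneous_1 homogeneous_mult)

lemma homogeneous_sum:
  assumes "\<And>i. i \<in> A \<Longrightarrow> homogeneous d (g i)"
  shows "homogeneous d (sum g A)"
  using assms
proof (induction A rule: infinite_finite_induct)
  case (insert x A)
  then show ?case using keys_add[of "g x" "sum g A"] by (auto simp: homogeneous_def)
qed (simp_all add: homogeneous_def)

definition hom_component :: "nat \<Rightarrow> ('v::finite, 'k::comm_ring_1) mpoly \<Rightarrow> ('v, 'k) mpoly" where
  "hom_component d f = (\<Sum>m | m \<in> keys f \<and> total_degree m = d. single m (lookup f m))"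

lemma lookup_hom_component:
  "lookup (hom_component d f) m = (if total_degree m = d then lookup f m else 0)"
  by (auto simp: hom_component_def lookup_sum lookup_single when_def sum.delta' in_keys_iff)

lemma keys_hom_component: "keys (hom_component d f) = {m \<in> keys f. total_degree m = d}"
  by (auto simp: in_keys_iff lookup_hom_component split: if_splits)

lemma hom_component_diff: "hom_component d (f - g) = hom_component d f - hom_component d g"
  by (rule poly_mapping_eqI) (simp add: lookup_hom_component lookup_minus)

lemma hom_component_sum: "hom_component d (sum g A) = (\<Sum>i\<in>A. hom_component d (g i))"
  by (rule poly_mapping_eqI) (simp add: lookup_hom_component lookup_sum)

lemma hom_component_homogeneous:
  "homogeneous e f \<Longrightarrow> hom_component d f = (if d = e then f else 0)"
  by (rule poly_mapping_eqI) (auto simp: lookup_hom_component homogeneous_def in_keys_iff)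

lemma homogeneous_hom_component: "homogeneous d (hom_component d f)"
  by (simp add: homogeneous_def keys_hom_component)

lemma sum_hom_component: "(\<Sum>d\<in>total_degree ` keys f. hom_component d f) = f"
  by (rule poly_mapping_eqI) (auto simp: lookup_sum lookup_hom_component in_keys_iff)

lemma hom_component_mult:
  assumes "homogeneous e f"
  shows "hom_component d (f * g) = (if e \<le> d then f * hom_component (d - e) g else 0)"
proof -
  let ?D = "total_degree ` keys g"
  have "hom_component d (f * g) = hom_component d (f * (\<Sum>j\<in>?D. hom_component j g))"
    by (simp add: sum_hom_component)
  also have "\<dots> = (\<Sum>j\<in>?D. if d = e + j then f * hom_component j g else 0)"
    unfolding sum_distrib_left hom_component_sum
    by (intro sum.cong refl hom_component_homogeneous homogeneous_mult assms homogeneous_hom_component)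
  also have "\<dots> = (\<Sum>j\<in>?D. if j = d - e then (if e \<le> d then f * hom_component (d - e) g else 0) else 0)"
    by (intro sum.cong refl) auto
  also have "\<dots> = (if e \<le> d then f * hom_component (d - e) g else 0)"
  proof (cases "d - e \<in> ?D")
    case False
    then have "hom_component (d - e) g = 0"
      by (intro poly_mapping_eqI)
        (auto simp: lookup_hom_component image_iff simp flip: not_in_keys_iff_lookup_eq_zero)
    then show ?thesis using False by simp
  qed simp
  finally show ?thesis .
qed

definition graded :: "('v::finite, 'k::comm_ring_1) mpoly set \<Rightarrow> bool" where
  "graded J \<longleftrightarrow> (\<forall>f\<in>J. \<forall>d. hom_component d f \<in> J)"

lemma graded_face_ideal: "graded (face_ideal \<Delta>)"
  by (simp add: graded_def face_ideal_def keys_hom_component)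

lemma graded_adjoin:
  assumes "is_ideal J" "graded J" "homogeneous e f"
  shows "graded (adjoin J f)"
  unfolding graded_def
proof (intro ballI allI)
  fix g d assume "g \<in> adjoin J f"
  then obtain r where "g - f * r \<in> J" using assms(1) by (auto simp: mem_adjoin_iff)
  then have "hom_component d (g - f * r) \<in> J" using assms(2) by (simp add: graded_def)
  then have "hom_component d g - f * (if e \<le> d then hom_component (d - e) r else 0) \<in> J"
    using assms(3) by (auto simp: hom_component_diff hom_component_mult split: if_splits)
  then show "hom_component d g \<in> adjoin J f" using assms(1) by (auto simp: mem_adjoin_iff)
qed

text \<open>Takes the place of Krull's intersection theorem: multiples of \<open>x ^ Suc d\<close>
  have no component in degree \<open>d\<close>, so the degree \<open>d\<close> part of
  \<open>g\<close> already lies in \<open>J\<close>.\<close>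

lemma graded_separated:
  assumes "is_ideal J" "graded J" "homogeneous e x" "e > 0" and g: "\<And>k. g \<in> adjoin J (x ^ k)"
  shows "g \<in> J"
proof -
  have "hom_component d g \<in> J" for d
  proof -
    obtain r where "g - x ^ Suc d * r \<in> J"
      using g[of "Suc d"] unfolding mem_adjoin_iff[OF assms(1)] by blast
    then have "hom_component d (g - x ^ Suc d * r) \<in> J" using assms(2) by (simp add: graded_def)
    moreover have "\<not> e * Suc d \<le> d" using assms(4) by (cases e) auto
    ultimately show ?thesis
      unfolding hom_component_diff hom_component_mult[OF homogeneous_power[OF assms(3)]] by simp
  qed
  then have "(\<Sum>d\<in>total_degree ` keys g. hom_component d g) \<in> J" by (intro ideal_sum assms)
  then show ?thesis by (simp add: sum_hom_component)
qed

text \<open>\<open>x\<close> passes one element at a time. Each passed element joins the ideal, and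
  its homogeneity keeps the ideal graded for the next exchange.\<close>

lemma weakly_regular_rotate:
  assumes "is_ideal J" "graded J" "homogeneous e x" "e > 0"
    and "\<forall>f\<in>set fs. \<exists>d. homogeneous d f" "weakly_regular J (x # fs)"
  shows "weakly_regular J (fs @ [x])"
  using assms
proof (induction fs arbitrary: J)
  case Nil
  then show ?case by simp
next
  case (Cons f fs)
  obtain d where d: "homogeneous d f" using Cons.prems(5) by auto
  have x: "\<And>g. x * g \<in> J \<Longrightarrow> g \<in> J" and f: "\<And>g. f * g \<in> adjoin J x \<Longrightarrow> g \<in> adjoin J x"
    and fs: "weakly_regular (adjoin (adjoin J f) x) fs"
    using Cons.prems(6) by (simp_all add: adjoin_commute[of J f x])
  note sep = graded_separated[OF Cons.prems(1-4)]
  note swap = regular_swap[OF Cons.prems(1) sep x f]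
  have "weakly_regular (adjoin J f) (fs @ [x])"
    using Cons.prems fs swap(2) d by (intro Cons.IH graded_adjoin) auto
  then show ?case using swap(1) by simp
qed

subsection \<open>Elementary symmetric polynomials on skeleta of a simplex\<close>

definition esym :: "'v set \<Rightarrow> nat \<Rightarrow> ('v, 'k::comm_ring_1) mpoly" where
  "esym A k = (\<Sum>S | S \<subseteq> A \<and> card S = k. sqfree_monomial S)"

lemma esym_0: "finite A \<Longrightarrow> esym A 0 = 1"
proof -
  assume "finite A"
  then have "{S. S \<subseteq> A \<and> card S = 0} = {{}}" by (auto dest: finite_subset)
  then show ?thesis by (simp add: esym_def sqfree_monomial_def)
qed

lemma esym_insert:
  assumes "finite A" "x \<notin> A"
  shows "esym (insert x A) (Suc k) = esym A (Suc k) + Var x * esym A k"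
proof -
  let ?S = "\<lambda>k. {S. S \<subseteq> A \<and> card S = k}"
  have fin: "finite S" if "S \<subseteq> A" for S using that assms finite_subset by blast
  have eq: "{S. S \<subseteq> insert x A \<and> card S = Suc k} = ?S (Suc k) \<union> insert x ` ?S k"
  proof (intro equalityI subsetI)
    fix S assume S: "S \<in> {S. S \<subseteq> insert x A \<and> card S = Suc k}"
    show "S \<in> ?S (Suc k) \<union> insert x ` ?S k"
    proof (cases "x \<in> S")
      case True
      then have "S = insert x (S - {x})" "S - {x} \<in> ?S k" using S by auto
      then show ?thesis by blast
    qed (use S in auto)
  next
    fix S assume "S \<in> ?S (Suc k) \<union> insert x ` ?S k"
    then show "S \<in> {S. S \<subseteq> insert x A \<and> card S = Suc k}"
      using assms fin by (auto simp: card_insert_if)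
  qed
  have inj: "inj_on (insert x) (?S k)"
    using assms(2) by (intro inj_on_inverseI[where g = "\<lambda>S. S - {x}"]) auto
  have "esym (insert x A) (Suc k) = esym A (Suc k) + (\<Sum>S\<in>insert x ` ?S k. sqfree_monomial S)"
    unfolding esym_def eq using assms by (intro sum.union_disjoint) auto
  also have "(\<Sum>S\<in>insert x ` ?S k. sqfree_monomial S) = (\<Sum>S\<in>?S k. Var x * sqfree_monomial S)"
    unfolding sum.reindex[OF inj] o_def
  proof (intro sum.cong refl)
    fix S assume "S \<in> ?S k"
    then have "x \<notin> S" "finite S" using assms fin by auto
    then show "sqfree_monomial (insert x S) = Var x * sqfree_monomial S"
      by (simp add: sqfree_monomial_def)
  qed
  finally show ?thesis by (simp add: esym_def sum_distrib_left)
qed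

lemma homogeneous_Var: "homogeneous 1 (Var x)"
  by (simp add: homogeneous_def Var_def total_degree_def lookup_single when_def)

lemma homogeneous_esym: "homogeneous k (esym A k)"
  unfolding esym_def
proof (intro homogeneous_sum)
  fix S assume "S \<in> {S. S \<subseteq> A \<and> card S = k}"
  then show "homogeneous k (sqfree_monomial S)"
    by (simp add: sqfree_monomial_conv_single homogeneous_def total_degree_def
        lookup_indicator_monomial sum.If_cases)
qed

definition skeleton :: "'v set \<Rightarrow> nat \<Rightarrow> 'v set set" where
  "skeleton U r = {F. F \<subseteq> U \<and> card F \<le> r}"

lemma down_closed_skeleton: "down_closed (skeleton (U :: 'v::finite set) r)"
  by (auto simp: down_closed_def skeleton_def intro: order.trans[OF card_mono])

text \<open>On the star of \<open>x\<close> in the skeleton, \<open>x\<close> is regular and the quotient by \<open>x\<close> is a smaller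
  skeleton. Modulo the first \<open>r\<close> elementary symmetric polynomials the next one is \<open>\<plusminus>x\<^sup>r\<^sup>+\<^sup>1\<close>.\<close>

lemma weakly_regular_star:
  fixes U :: "'v::finite set" and x :: 'v and r :: nat
  defines "\<Gamma> \<equiv> {F. F \<subseteq> insert x U \<and> card (F - {x}) \<le> r}"
  assumes "x \<notin> U"
    and IH: "weakly_regular (face_ideal (skeleton U r) :: ('v, 'k::comm_ring_1) mpoly set)
              (map (esym UNIV) [1..<Suc r])"
  shows "weakly_regular (face_ideal \<Gamma> :: ('v, 'k) mpoly set) (map (esym UNIV) [1..<Suc (Suc r)])"
proof -
  define J where "J = (face_ideal \<Gamma> :: ('v, 'k) mpoly set)"
  let ?E = "map (esym UNIV) [1..<Suc r] :: ('v, 'k) mpoly list"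
  have \<Gamma>: "down_closed \<Gamma>"
    unfolding down_closed_def \<Gamma>_def
    by (auto intro: order.trans[OF card_mono[OF _ Diff_mono[OF _ subset_refl]]])
  then have J: "is_ideal J" by (simp add: J_def is_ideal_face_ideal)
  \<comment> \<open>\<open>\<Gamma>\<close> is a cone with apex \<open>x\<close>, so the colon ideal
    by \<open>x\<close> is \<open>J\<close> itself.\<close>
  have "{F. insert x F \<in> \<Gamma>} = \<Gamma>"
    by (auto simp: \<Gamma>_def insert_Diff_if)
  then have "g \<in> J" if "Var x * g \<in> J" for g
    using that by (simp add: J_def Var_mult_in_face_ideal_iff)
  moreover have "{F \<in> \<Gamma>. x \<notin> F} = skeleton U r"
    using assms(2) by (auto simp: \<Gamma>_def skeleton_def card_Diff_singleton_if)
  then have "weakly_regular (adjoin J (Var x)) ?E"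
    using IH \<Gamma> by (simp add: J_def adjoin_Var_face_ideal)
  ultimately have "weakly_regular J (Var x # ?E)" by simp
  \<comment> \<open>With \<open>x\<close> last, \<open>x\<close> is a nonzerodivisor modulo the
    first \<open>r\<close> elementary symmetric polynomials.\<close>
  then have "weakly_regular J (?E @ [Var x])"
    using J graded_face_ideal homogeneous_esym
    by (intro weakly_regular_rotate[OF _ _ homogeneous_Var]) (auto simp: J_def)
  define Q where "Q = foldl adjoin J ?E"
  have Q: "is_ideal Q" and JQ: "J \<subseteq> Q" and EQ: "set ?E \<subseteq> Q"
    using ideal_gen_superset[of "J \<union> set ?E"] J
    by (simp_all only: Q_def foldl_adjoin is_ideal_ideal_gen) auto
  have reg: "weakly_regular J ?E" and xQ: "\<And>g. Var x * g \<in> Q \<Longrightarrow> g \<in> Q"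
    using \<open>weakly_regular J (?E @ [Var x])\<close> by (simp_all only: weakly_regular_append Q_def weakly_regular.simps)
  let ?e = "esym (UNIV - {x}) :: nat \<Rightarrow> ('v, 'k) mpoly"
  have rec: "esym UNIV (Suc k) = ?e (Suc k) + Var x * ?e k" for k
    using esym_insert[of "UNIV - {x}" x k] by (simp add: insert_absorb)
  \<comment> \<open>Modulo \<open>Q\<close> the left side of \<open>rec\<close> vanishes, so each
    \<open>?e (Suc k)\<close> is \<open>- Var x\<close> times its predecessor, starting from
    \<open>?e 0 = 1\<close>.\<close>
  have e: "?e k - (- Var x) ^ k \<in> Q" if "k \<le> r" for k
    using that
  proof (induction k)
    case 0
    then show ?case using ideal_zero[OF Q] by (simp add: esym_0)
  next
    case (Suc k)
    have "Suc k \<in> set [1..<Suc r]" using Suc.prems by auto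
    then have "esym UNIV (Suc k) \<in> Q" using EQ by (metis image_eqI list.set_map subsetD)
    moreover have "Var x * (?e k - (- Var x) ^ k) \<in> Q"
      using Suc by (intro ideal_mult[OF Q]) auto
    ultimately have "esym UNIV (Suc k) - Var x * (?e k - (- Var x) ^ k) \<in> Q"
      by (rule ideal_diff[OF Q])
    then show ?case unfolding rec by (simp add: algebra_simps)
  qed
  \<comment> \<open>Its terms are products of \<open>r + 1\<close> distinct vertices other than
    \<open>x\<close>, which are never faces of \<open>\<Gamma>\<close>. Only the summand
    \<open>Var x * ?e r\<close> of the next symmetric polynomial survives, a power of
    \<open>x\<close> up to sign.\<close>
  have "?e (Suc r) \<in> J"
    unfolding esym_def
  proof (intro ideal_sum J)
    fix S assume "S \<in> {S. S \<subseteq> UNIV - {x} \<and> card S = Suc r}"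
    then have "S \<notin> \<Gamma>" by (auto simp: \<Gamma>_def card_Diff_singleton_if)
    then show "sqfree_monomial S \<in> J" by (simp add: J_def sqfree_monomial_in_face_ideal)
  qed
  then have "?e (Suc r) \<in> Q" using JQ by blast
  then have "?e (Suc r) + Var x * (?e r - (- Var x) ^ r) \<in> Q"
    by (rule ideal_add[OF Q _ ideal_mult[OF Q e[OF order.refl]]])
  then have er: "esym UNIV (Suc r) - (- ((- Var x) ^ Suc r)) \<in> Q"
    unfolding rec by (simp add: algebra_simps)
  have "g \<in> Q" if "esym UNIV (Suc r) * g \<in> Q" for g
  proof -
    have "(esym UNIV (Suc r) - (- ((- Var x) ^ Suc r))) * g \<in> Q" by (intro ideal_mult_right Q er)
    from ideal_diff[OF Q this that] have "(- Var x) ^ Suc r * g \<in> Q" by (simp add: algebra_simps)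
    then show ?thesis
    proof (rule regular_power[rotated])
      fix h assume "- Var x * h \<in> Q"
      then have "- (- Var x * h) \<in> Q" by (rule ideal_uminus[OF Q])
      then show "h \<in> Q" using xQ by simp
    qed
  qed
  then have "weakly_regular J (?E @ [esym UNIV (Suc r)])"
    using reg by (simp add: weakly_regular_append Q_def)
  then show ?thesis by (simp add: J_def)
qed

text \<open>The ring stays fixed while \<open>U\<close> shrinks: variables outside \<open>U\<close>
  lie in the face ideal. The bound on \<open>r\<close> keeps the sequence no longer than the largest
  face.\<close>

lemma weakly_regular_skeleton:
  fixes U :: "'v::finite set"
  assumes "r \<le> card U"
  shows "weakly_regular (face_ideal (skeleton U r) :: ('v, 'k::comm_ring_1) mpoly set)
    (map (esym UNIV) [1..<Suc r])"
proof -
  have "finite U" by simp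
  then show ?thesis
    using assms
  proof (induction U arbitrary: r rule: finite_induct)
    case empty
    then show ?case by simp
  next
    case (insert x U)
    show ?case
    proof (cases r)
      case 0
      then show ?thesis by simp
    next
      case (Suc q)
      let ?\<Gamma> = "{F. F \<subseteq> insert x U \<and> card (F - {x}) \<le> q}"
      have "q \<le> card U" using insert Suc by simp
      then have star: "weakly_regular (face_ideal ?\<Gamma> :: ('v, 'k) mpoly set) (map (esym UNIV) [1..<Suc r])"
        using weakly_regular_star[OF insert.hyps(2) insert.IH] by (simp add: Suc)
      show ?thesis
      proof (cases "r \<le> card U")
        case True
        have "{F. insert x F \<in> skeleton (insert x U) r} = ?\<Gamma>"
          by (auto simp: skeleton_def Suc card_insert_if card_Diff_singleton_if)
        moreover have "{F \<in> skeleton (insert x U) r. x \<notin> F} = skeleton U r"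
          using insert.hyps by (auto simp: skeleton_def)
        ultimately have "{g. Var x * g \<in> face_ideal (skeleton (insert x U) r)} =
              (face_ideal ?\<Gamma> :: ('v, 'k) mpoly set)"
            and "adjoin (face_ideal (skeleton (insert x U) r)) (Var x) =
              (face_ideal (skeleton U r) :: ('v, 'k) mpoly set)"
          by (simp_all add: Var_mult_in_face_ideal_iff adjoin_Var_face_ideal down_closed_skeleton)
        then show ?thesis
          using star insert.IH[OF True]
          by (simp only: weakly_regular_exact[OF is_ideal_face_ideal[OF down_closed_skeleton], of "Var x"])
      next
        \<comment> \<open>Here the deletion has too few vertices for the induction hypothesis, but
          the skeleton is the full simplex and hence equal to the star of \<open>x\<close>.\<close>
        case False
        then have "r = Suc (card U)" "q = card U" using insert Suc by auto
        then have "card (F - {x}) \<le> q \<and> card F \<le> r" if "F \<subseteq> insert x U" for F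
          using card_mono[of "insert x U" F] card_mono[of U "F - {x}"] insert.hyps that by auto
        then have "?\<Gamma> = skeleton (insert x U) r" by (auto simp: skeleton_def)
        then show ?thesis using star by simp
      qed
    qed
  qed
qed

subsection \<open>A Koszul complex on tuples\<close>

text \<open>Cochains are arbitrary functions on lists, of which degree \<open>i\<close> only sees the lists of
  length \<open>i\<close>. Unlike in the exterior algebra no alternation is imposed; multiplication by a linear
  form is still anticommutative, and no signs of permutations are needed.\<close>

primrec wedge :: "('v \<Rightarrow> 'a::comm_ring_1) \<Rightarrow> ('v list \<Rightarrow> 'a) \<Rightarrow> 'v list \<Rightarrow> 'a" where
  "wedge y w [] = 0"
| "wedge y w (v # vs) = y v * w vs - wedge y (\<lambda>us. w (v # us)) vs"

lemma wedge_0 [simp]: "wedge y (\<lambda>_. 0) vs = 0"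
  by (induction vs) simp_all

lemma wedge_0_left [simp]: "wedge (\<lambda>_. 0) w vs = 0"
  by (induction vs arbitrary: w) simp_all

lemma wedge_add: "wedge y (\<lambda>us. a us + b us) vs = wedge y a vs + wedge y b vs"
  by (induction vs arbitrary: a b) (simp_all add: algebra_simps)

lemma wedge_diff: "wedge y (\<lambda>us. a us - b us) vs = wedge y a vs - wedge y b vs"
  by (induction vs arbitrary: a b) (simp_all add: algebra_simps)

lemma wedge_scale: "wedge y (\<lambda>us. c * w us) vs = c * wedge y w vs"
  by (induction vs arbitrary: w) (simp_all add: algebra_simps)

lemma wedge_sum: "wedge y (\<lambda>us. \<Sum>i\<in>A. w i us) vs = (\<Sum>i\<in>A. wedge y (w i) vs)"
  by (induction A rule: infinite_finite_induct) (simp_all add: wedge_add)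

lemma wedge_add_left: "wedge (\<lambda>v. y v + z v) w vs = wedge y w vs + wedge z w vs"
  by (induction vs arbitrary: w) (simp_all add: algebra_simps)

lemma wedge_sum_left: "wedge (\<lambda>v. \<Sum>i\<in>A. y i v) w vs = (\<Sum>i\<in>A. wedge (y i) w vs)"
  by (induction A rule: infinite_finite_induct) (simp_all add: wedge_add_left)

lemma wedge_anticommute: "wedge y (wedge z w) vs = - wedge z (wedge y w) vs"
proof (induction vs arbitrary: w)
  case (Cons v vs)
  show ?case by (simp add: wedge_diff wedge_scale Cons.IH)
qed simp

text \<open>In characteristic 2 this is no consequence of \<open>wedge_anticommute\<close>, so it
  has its own induction.\<close>

lemma wedge_self: "wedge y (wedge y w) vs = 0"
proof (induction vs arbitrary: w)
  case (Cons v vs)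
  show ?case by (simp add: wedge_diff wedge_scale Cons.IH)
qed simp

lemma wedge_in_ideal:
  assumes "is_ideal J" "\<And>us. length us = n \<Longrightarrow> w us \<in> J" "length vs = Suc n"
  shows "wedge y w vs \<in> J"
  using assms(2,3)
proof (induction vs arbitrary: n w)
  case (Cons v vs)
  have "wedge y (\<lambda>us. w (v # us)) vs \<in> J"
  proof (cases n)
    case 0
    then show ?thesis using Cons.prems(2) ideal_zero[OF assms(1)] by simp
  next
    case (Suc k)
    then show ?thesis using Cons.prems by (intro Cons.IH[of k]) auto
  qed
  then show ?case using Cons.prems by (simp add: ideal_diff ideal_mult assms(1))
qed simp

lemma wedge_in_ideal':
  assumes "is_ideal J" "\<And>v us. y v * w us \<in> J"
  shows "wedge y w vs \<in> J"
  using assms(2) by (induction vs arbitrary: w) (simp_all add: ideal_zero ideal_diff assms(1))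

lemma wedge_cong:
  assumes "\<And>us. length us = n \<Longrightarrow> w us = w' us" "length vs = Suc n"
  shows "wedge y w vs = wedge y w' vs"
proof -
  have "is_ideal {0 :: 'b}" by (simp add: is_ideal_def)
  then have "wedge y (\<lambda>us. w us - w' us) vs \<in> {0}"
    using assms by (intro wedge_in_ideal[where n = n]) auto
  then show ?thesis by (simp add: wedge_diff)
qed

text \<open>The homotopy formula: contraction by \<open>c\<close> in the first argument, composed in
  both orders with the differential \<open>wedge x\<close>, adds up to multiplication by the pairing
  of \<open>c\<close> and \<open>x\<close>.\<close>

lemma contraction_wedge:
  fixes x c :: "'v::finite \<Rightarrow> 'a::comm_ring_1"
  shows "(\<Sum>v\<in>UNIV. c v * wedge x w (v # us)) =
    (\<Sum>v\<in>UNIV. c v * x v) * w us - wedge x (\<lambda>us. \<Sum>v\<in>UNIV. c v * w (v # us)) us"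
  by (simp add: wedge_sum wedge_scale sum_subtractf sum_distrib_right
      sum_distrib_left right_diff_distrib mult_ac)

text \<open>A regular sequence of length \<open>n\<close> in the ideal generated by the \<open>x v\<close> makes the complex
  exact in degrees below \<open>n\<close>: each element of that ideal acts null-homotopically.\<close>

lemma koszul_exact:
  fixes x :: "'v::finite \<Rightarrow> 'a::comm_ring_1"
  assumes "is_ideal J" "weakly_regular J fs"
    and "\<forall>f\<in>set fs. \<exists>c. f = (\<Sum>v\<in>UNIV. c v * x v)"
    and "i < length fs" "\<And>vs. length vs = Suc i \<Longrightarrow> wedge x w vs \<in> J"
  shows "\<exists>\<eta>. \<forall>vs. length vs = i \<longrightarrow> w vs - wedge x \<eta> vs \<in> J"
  using assms
proof (induction fs arbitrary: J i w)
  case Nil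
  then show ?case by simp
next
  case (Cons f fs)
  note J = Cons.prems(1)
  obtain c where c: "f = (\<Sum>v\<in>UNIV. c v * x v)" using Cons.prems(3) by auto
  have reg: "\<And>g. f * g \<in> J \<Longrightarrow> g \<in> J" using Cons.prems(2) by simp
  define hw where "hw = (\<lambda>us. \<Sum>v\<in>UNIV. c v * w (v # us))"
  have hdw: "f * w us - wedge x hw us \<in> J" if "length us = i" for us
    unfolding c hw_def contraction_wedge[symmetric]
    by (intro ideal_sum ideal_mult J Cons.prems(5)) (simp add: that)
  show ?case
  proof (cases i)
    case 0
    then have "w [] \<in> J" using hdw[of "[]"] reg by simp
    then show ?thesis using 0 by simp
  next
    case (Suc j)
    \<comment> \<open>By \<open>hdw\<close> the coboundary of \<open>hw\<close> is
      \<open>f * w\<close> modulo \<open>J\<close>, so \<open>hw\<close> is a cocycle modulo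
      \<open>f\<close>, one degree lower. By induction it is
      \<open>wedge x \<eta> + f * \<zeta>\<close>; applying the differential once more gives
      \<open>f * w = f * wedge x \<zeta>\<close> modulo \<open>J\<close>, and \<open>f\<close>
      cancels.\<close>
    have "wedge x hw us \<in> adjoin J f" if "length us = Suc j" for us
      using ideal_uminus[OF J hdw[of us]] that J
      by (auto simp: mem_adjoin_iff Suc intro!: exI[of _ "w us"])
    then obtain \<eta> where \<eta>: "\<And>us. length us = j \<Longrightarrow> hw us - wedge x \<eta> us \<in> adjoin J f"
      using Cons.IH[of "adjoin J f" j hw] Cons.prems Suc by auto
    define \<zeta> where "\<zeta> us = (SOME r. hw us - wedge x \<eta> us - f * r \<in> J)" for us
    have \<zeta>: "hw us - wedge x \<eta> us - f * \<zeta> us \<in> J" if "length us = j" for us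
      unfolding \<zeta>_def using \<eta>[OF that] J by (intro someI_ex[of "\<lambda>r. _ - f * r \<in> J"]) (simp add: mem_adjoin_iff)
    have "w vs - wedge x \<zeta> vs \<in> J" if vs: "length vs = i" for vs
    proof -
      have "wedge x (\<lambda>us. hw us - wedge x \<eta> us - f * \<zeta> us) vs \<in> J"
        using \<zeta> vs J by (intro wedge_in_ideal[where n = j]) (simp_all add: Suc)
      then have "wedge x hw vs - f * wedge x \<zeta> vs \<in> J"
        by (simp add: wedge_diff wedge_scale wedge_self)
      from ideal_add[OF J hdw[OF vs] this] have "f * (w vs - wedge x \<zeta> vs) \<in> J"
        by (simp add: algebra_simps)
      then show ?thesis by (rule reg)
    qed
    then show ?thesis by blast
  qed
qed

lemma max_ideal_linear_combination:
  assumes "f \<in> (max_ideal :: ('v::finite, 'k::comm_ring_1) mpoly set)"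
  shows "\<exists>c. f = (\<Sum>v\<in>UNIV. c v * Var v)"
proof -
  let ?I = "{f. \<exists>c. f = (\<Sum>v\<in>UNIV. c v * Var v)} :: ('v, 'k) mpoly set"
  have "is_ideal ?I"
    unfolding is_ideal_def
  proof (intro conjI ballI allI)
    show "0 \<in> ?I" by (auto intro!: exI[of _ "\<lambda>_. 0"])
    show "a + b \<in> ?I" if "a \<in> ?I" "b \<in> ?I" for a b
      using that by (auto simp flip: sum.distrib distrib_right)
    show "r * a \<in> ?I" if "a \<in> ?I" for r a
      using that by (auto simp: sum_distrib_left mult.assoc[symmetric])
  qed
  moreover have "Var u \<in> ?I" for u
    by (auto intro!: exI[of _ "\<lambda>v. if v = u then 1 else 0"] simp: if_distrib[of "\<lambda>a. a * _"] cong: if_cong)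
  ultimately show ?thesis
    using assms ideal_gen_least[of ?I "range Var"] unfolding max_ideal_def by blast
qed

subsection \<open>The depth of a complete multipartite hypergraph\<close>

text \<open>The part of \<open>Var\<close> supported on one side: summed over the partition these
  forms give \<open>Var\<close>. They are the pullbacks of the coordinates of the simplex on the
  sides.\<close>

definition side_form :: "'v set \<Rightarrow> 'v \<Rightarrow> ('v, 'k::comm_ring_1) mpoly" where
  "side_form A v = (if v \<in> A then Var v else 0)"

primrec side_product :: "'v set list \<Rightarrow> 'v list \<Rightarrow> ('v, 'k::comm_ring_1) mpoly" where
  "side_product [] = (\<lambda>vs. if vs = [] then 1 else 0)"
| "side_product (A # As) = wedge (side_form A) (side_product As)"

text \<open>Each factor of the product contributes a variable of its own side to every term.\<close>

lemma side_product_in_face_ideal: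
  "(side_product As vs :: ('v, 'k::comm_ring_1) mpoly) \<in> face_ideal {F. \<exists>A\<in>set As. F \<inter> A = {}}"
proof (induction As arbitrary: vs)
  case Nil
  show ?case by (simp add: face_ideal_def)
next
  case (Cons A As)
  let ?\<Delta> = "{F. \<exists>B\<in>set (A # As). F \<inter> B = {}}"
  have down: "down_closed ?\<Delta>" unfolding down_closed_def by blast
  have "side_form A v * side_product As us \<in> (face_ideal ?\<Delta> :: ('v, 'k) mpoly set)" for v us
  proof (cases "v \<in> A")
    case True
    then have "side_product As us \<in> (face_ideal {F. insert v F \<in> ?\<Delta>} :: ('v, 'k) mpoly set)"
      by (intro subsetD[OF face_ideal_antimono Cons.IH]) auto
    then show ?thesis
      using True by (simp only: side_form_def if_True Var_mult_in_face_ideal_iff)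
  next
    case False
    then show ?thesis by (simp add: side_form_def ideal_zero is_ideal_face_ideal down del: list.set)
  qed
  then show ?case
    using down by (simp only: side_product.simps wedge_in_ideal' is_ideal_face_ideal)
qed

text \<open>Anticommutativity moves the new factor next to its twin, where \<open>wedge_self\<close>
  applies.\<close>

lemma wedge_side_product_mem:
  "A \<in> set As \<Longrightarrow> wedge (side_form A) (side_product As) vs = (0 :: ('a, 'b::comm_ring_1) mpoly)"
proof (induction As arbitrary: vs)
  case (Cons B As)
  show ?case
  proof (cases "A = B")
    case False
    then have "A \<in> set As" using Cons.prems by simp
    from Cons.IH[OF this]
    have "wedge (side_form A) (side_product As) = (\<lambda>_. 0 :: ('a, 'b) mpoly)" by (intro ext)
    then have "wedge (side_form B) (wedge (side_form A) (side_product As)) vs = (0 :: ('a, 'b) mpoly)"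
      by (metis wedge_0)
    then show ?thesis by (simp, subst wedge_anticommute) simp
  qed (simp add: wedge_self)
qed simp

lemma side_product_eq_0:
  "\<forall>A\<in>set As. v \<notin> A \<Longrightarrow> side_product As (v # us) = 0"
  by (induction As arbitrary: us) (simp_all add: side_form_def)

text \<open>The value is the determinant of the matrix with entries \<open>side_form A v\<close>;
  disjoint sides make it diagonal.\<close>

lemma side_product_transversal:
  assumes "list_all2 (\<in>) vs As" "distinct As" "disjoint (set As)"
  shows "side_product As vs = prod_list (map Var vs)"
  using assms
proof (induction rule: list_all2_induct)
  case (Cons v vs A As)
  have "v \<notin> B" if "B \<in> set As" for B
    using Cons.hyps(1) Cons.prems that by (auto dest!: disjointD[of _ A B])
  then have "side_product As (v # us) = (0 :: ('a, 'b) mpoly)" for us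
    by (intro side_product_eq_0) blast
  moreover have "disjoint (set As)" using Cons.prems(2) by (auto simp: disjoint_def)
  ultimately show ?case using Cons by (simp add: side_form_def)
qed simp

section \<open>Monomials of vertex lists and the faces of the independence complex\<close>

definition list_monomial :: "'v list \<Rightarrow> 'v \<Rightarrow>\<^sub>0 nat" where
  "list_monomial vs = sum_list (map (\<lambda>v. single v 1) vs)"

lemma keys_list_monomial: "keys (list_monomial vs) = set vs"
  by (induction vs) (simp_all add: list_monomial_def keys_plus_nat)

lemma prod_list_Var: "prod_list (map Var vs) = single (list_monomial vs) 1"
  by (induction vs) (simp_all add: list_monomial_def Var_def mult_single)

text \<open>Reading off, at each list, the coefficient of its own monomial turns the Koszul
  differential into the coboundary of scalar cochains: multiplying by \<open>Var v\<close> shifts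
  exponents just as prepending \<open>v\<close> to the list does. The offset \<open>m\<close>
  absorbs the entries already split off in the induction.\<close>

lemma lookup_wedge_Var:
  "lookup (wedge Var \<eta> vs) (m + list_monomial vs) =
   wedge (\<lambda>_. 1) (\<lambda>us. lookup (\<eta> us) (m + list_monomial us)) vs"
proof (induction vs arbitrary: \<eta> m)
  case (Cons v vs)
  have eq: "m + list_monomial (v # us) = m + single v 1 + list_monomial us" for us
    by (simp add: list_monomial_def add.assoc)
  have "lookup (Var v * \<eta> vs) (single v 1 + (m + list_monomial vs)) = lookup (\<eta> vs) (m + list_monomial vs)"
    by (simp add: Var_def lookup_single_mult)
  then have "lookup (Var v * \<eta> vs) (m + list_monomial (v # vs)) = lookup (\<eta> vs) (m + list_monomial vs)"
    by (simp add: eq add_ac)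
  moreover have "lookup (wedge Var (\<lambda>us. \<eta> (v # us)) vs) (m + list_monomial (v # vs)) =
    wedge (\<lambda>_. 1) (\<lambda>us. lookup (\<eta> (v # us)) (m + list_monomial (v # us))) vs"
    unfolding eq by (rule Cons.IH)
  ultimately show ?case by (simp add: lookup_minus)
qed simp

lemma multipartite_face_iff:
  fixes P :: "'v::finite set set"
  assumes "complete_uniform_multipartite P s H"
  shows "F \<in> independence_complex H \<longleftrightarrow> card {A \<in> P. F \<inter> A \<noteq> {}} < s"
proof -
  have P: "partition_on UNIV P" and H: "H = {e. card e = s \<and> (\<forall>A\<in>P. card (e \<inter> A) \<le> 1)}"
    using assms by (auto simp: complete_uniform_multipartite_def)
  have "(\<exists>e\<in>H. e \<subseteq> F) \<longleftrightarrow> s \<le> card {A \<in> P. F \<inter> A \<noteq> {}}"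
  proof
    assume "\<exists>e\<in>H. e \<subseteq> F"
    then obtain e where e: "card e = s" "\<forall>A\<in>P. card (e \<inter> A) \<le> 1" "e \<subseteq> F" by (auto simp: H)
    let ?S = "{A \<in> P. e \<inter> A \<noteq> {}}"
    have "e \<subseteq> (\<Union>A\<in>?S. e \<inter> A)" using P by (auto simp: partition_on_def)
    then have "card e \<le> card (\<Union>A\<in>?S. e \<inter> A)" by (intro card_mono) auto
    also have "\<dots> \<le> (\<Sum>A\<in>?S. card (e \<inter> A))" by (intro card_UN_le) auto
    also have "\<dots> \<le> (\<Sum>A\<in>?S. 1)" using e(2) by (intro sum_mono) auto
    also have "\<dots> = card ?S" by simp
    also have "\<dots> \<le> card {A \<in> P. F \<inter> A \<noteq> {}}" using e(3) by (intro card_mono) auto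
    finally show "s \<le> card {A \<in> P. F \<inter> A \<noteq> {}}" using e(1) by simp
  next
    assume "s \<le> card {A \<in> P. F \<inter> A \<noteq> {}}"
    then obtain S where S: "S \<subseteq> {A \<in> P. F \<inter> A \<noteq> {}}" "card S = s"
      by (meson obtain_subset_with_card_n)
    then have "\<forall>A\<in>S. \<exists>v. v \<in> F \<inter> A" by auto
    then obtain f where f: "\<And>A. A \<in> S \<Longrightarrow> f A \<in> F \<inter> A" by metis
    have uniq: "A = B" if "A \<in> S" "B \<in> P" "f A \<in> B" for A B
      using that S f[of A] P disjointD[of P A B] by (auto simp: partition_on_def)
    have "inj_on f S" using uniq f S by (intro inj_onI) (metis (no_types, lifting) IntD2 mem_Collect_eq subsetD)
    then have "card (f ` S) = s" using S by (simp add: card_image)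
    moreover have "card (f ` S \<inter> A) \<le> 1" if "A \<in> P" for A
    proof -
      have "f ` S \<inter> A \<subseteq> {f A}" using uniq that by auto
      from card_mono[OF _ this] show ?thesis by simp
    qed
    ultimately have "f ` S \<in> H" by (simp add: H)
    then show "\<exists>e\<in>H. e \<subseteq> F" using f by blast
  qed
  then show ?thesis by (auto simp: independence_complex_def not_le)
qed

text \<open>The product of the linear forms of \<open>s - 1\<close> sides is a cocycle that is not a coboundary, since
  it is the pullback of a nontrivial cohomology class of the \<open>(s - 2)\<close>-skeleton of the simplex on
  the sides.\<close>

lemma multipartite_regular_sequence_length:
  fixes P :: "'v::finite set set" and fs :: "('v, 'k::comm_ring_1) mpoly list"
  assumes cump: "complete_uniform_multipartite P s H" and s: "1 \<le> s" "s \<le> card P"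
    and fs: "weakly_regular (face_ideal (independence_complex H)) fs" "set fs \<subseteq> max_ideal"
  shows "length fs < s"
proof (rule ccontr)
  assume "\<not> length fs < s"
  then have len: "s - 1 < length fs" using s by linarith
  have P: "partition_on UNIV P" and "finite P"
    using cump by (auto simp: complete_uniform_multipartite_def)
  define I where "I = (face_ideal (independence_complex H) :: ('v, 'k) mpoly set)"
  have I: "is_ideal I" by (simp add: I_def is_ideal_face_ideal down_closed_independence_complex)
  \<comment> \<open>One side more than the cocycle uses: \<open>As\<close> defines the cocycle, and
    \<open>A0\<close> shows that it is not a coboundary.\<close>
  obtain S where S: "S \<subseteq> P" "card S = s" using s(2) by (meson obtain_subset_with_card_n)
  obtain Bs where Bs: "set Bs = S" "distinct Bs" using finite_distinct_list[of S] by auto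
  then have "length Bs = s" using S by (metis distinct_card)
  then obtain A0 As where As: "Bs = A0 # As" "length As = s - 1" using s by (cases Bs) auto
  have sides: "A0 \<in> P" "set As \<subseteq> P" "A0 \<notin> set As" "distinct As"
    using S Bs As by auto
  have disj: "disjoint P" and nonempty: "{} \<notin> P" using P by (auto simp: partition_on_def)
  define rep where "rep A = (SOME v. v \<in> A)" for A :: "'v set"
  have rep: "rep A \<in> A" if "A \<in> P" for A
    using that nonempty unfolding rep_def by (metis ex_in_conv someI_ex)
  define vs where "vs = map rep As"
  have vs: "list_all2 (\<in>) vs As" "length vs = s - 1"
    using rep sides As by (auto simp: vs_def list_all2_conv_all_nth subset_iff)
  define w where "w = (side_product As :: 'v list \<Rightarrow> ('v, 'k) mpoly)"
  \<comment> \<open>Split \<open>Var\<close> into side forms. A side in \<open>As\<close> repeats a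
    factor and gives 0; any other side yields a product over \<open>s\<close> distinct sides, whose
    monomials are all supported on non-faces.\<close>
  have "wedge Var w us \<in> I" for us
  proof -
    have "Var v = (\<Sum>A\<in>P. side_form A v :: ('v, 'k) mpoly)" for v
    proof -
      have "v \<in> \<Union>P" using P by (auto simp: partition_on_def)
      then obtain A where A: "A \<in> P" "v \<in> A" by blast
      then have "side_form B v = (if B = A then Var v else 0 :: ('v, 'k) mpoly)" if "B \<in> P" for B
        using that disjointD[OF disj, of A B] by (auto simp: side_form_def)
      then have "(\<Sum>B\<in>P. side_form B v) = (\<Sum>B\<in>P. if B = A then Var v else 0 :: ('v, 'k) mpoly)"
        by (rule sum.cong[OF refl])
      then show ?thesis using A \<open>finite P\<close> by simp
    qed
    then have "(Var :: 'v \<Rightarrow> ('v, 'k) mpoly) = (\<lambda>v. \<Sum>A\<in>P. side_form A v)" by (intro ext)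
    then have "wedge Var w us = wedge (\<lambda>v. \<Sum>A\<in>P. side_form A v) w us"
      by (rule arg_cong[where f = "\<lambda>y. wedge y w us"])
    also have "\<dots> = (\<Sum>A\<in>P. wedge (side_form A) w us)" by (rule wedge_sum_left)
    also have "\<dots> \<in> I"
    proof (rule ideal_sum[OF I])
      fix A assume "A \<in> P"
      show "wedge (side_form A) w us \<in> I"
      proof (cases "A \<in> set As")
        case True
        then show ?thesis by (simp add: w_def wedge_side_product_mem ideal_zero I)
      next
        case False
        have "independence_complex H \<subseteq> {F. \<exists>B\<in>set (A # As). F \<inter> B = {}}"
        proof
          fix F assume "F \<in> independence_complex H"
          then have lt: "card {B \<in> P. F \<inter> B \<noteq> {}} < s" using multipartite_face_iff[OF cump] by simp
          have "card (set (A # As)) = s"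
            using False sides As s distinct_card[of "A # As"] by simp
          moreover have "finite {B \<in> P. F \<inter> B \<noteq> {}}" by simp
          ultimately have "\<not> set (A # As) \<subseteq> {B \<in> P. F \<inter> B \<noteq> {}}"
            using lt card_mono by (metis not_le)
          then show "F \<in> {F. \<exists>B\<in>set (A # As). F \<inter> B = {}}"
            using sides \<open>A \<in> P\<close> by auto
        qed
        then have "face_ideal {F. \<exists>B\<in>set (A # As). F \<inter> B = {}} \<subseteq> I"
          unfolding I_def by (rule face_ideal_antimono)
        moreover have "wedge (side_form A) w us = side_product (A # As) us" by (simp add: w_def)
        ultimately show ?thesis using side_product_in_face_ideal[of "A # As" us] by auto
      qed
    qed
    finally show ?thesis .
  qed
  then obtain \<eta> where \<eta>: "\<And>us. length us = s - 1 \<Longrightarrow> w us - wedge Var \<eta> us \<in> I"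
    using koszul_exact[of I fs Var "s - 1" w] I fs len max_ideal_linear_combination
    unfolding I_def by blast
  define b where "b us = lookup (w us) (list_monomial us)" for us
  define c where "c us = lookup (\<eta> us) (list_monomial us)" for us
  have bc: "wedge (\<lambda>_. 1) c us = b us" if "length us = s - 1" for us
  proof -
    \<comment> \<open>A list of \<open>s - 1\<close> vertices meets at most \<open>s - 1\<close>
      sides, so its support is a face. Elements of \<open>I\<close> have coefficient 0 there, and
      the congruence modulo \<open>I\<close> becomes an equation of scalars.\<close>
    have "card {A \<in> P. set us \<inter> A \<noteq> {}} \<le> card (set us)"
    proof (rule card_inj_on_le)
      let ?f = "\<lambda>A. SOME v. v \<in> set us \<inter> A"
      have f: "?f A \<in> set us \<inter> A" if "set us \<inter> A \<noteq> {}" for A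
        using that by (metis ex_in_conv someI_ex)
      show "inj_on ?f {A \<in> P. set us \<inter> A \<noteq> {}}"
      proof (rule inj_onI)
        fix A B assume A: "A \<in> {A \<in> P. set us \<inter> A \<noteq> {}}" and B: "B \<in> {A \<in> P. set us \<inter> A \<noteq> {}}"
          and "?f A = ?f B"
        then have "?f A \<in> A \<inter> B" using f[of A] f[of B] by auto
        then show "A = B" using disjointD[OF disj, of A B] A B by blast
      qed
      show "?f ` {A \<in> P. set us \<inter> A \<noteq> {}} \<subseteq> set us" using f by blast
    qed simp
    also have "\<dots> < s" using card_length[of us] that s by linarith
    finally have "set us \<in> independence_complex H" by (simp add: multipartite_face_iff[OF cump])
    then have "list_monomial us \<notin> keys (w us - wedge Var \<eta> us)"
      using \<eta>[OF that] by (auto simp: I_def face_ideal_def keys_list_monomial)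
    then have "lookup (w us) (list_monomial us) = lookup (wedge Var \<eta> us) (0 + list_monomial us)"
      by (simp add: in_keys_iff lookup_minus)
    also have "\<dots> = wedge (\<lambda>_. 1) c us" unfolding lookup_wedge_Var c_def by simp
    finally show ?thesis by (simp add: b_def)
  qed
  have b0: "b (rep A0 # us) = 0" for us
  proof -
    have "rep A0 \<notin> B" if "B \<in> set As" for B
      using rep[of A0] sides that disjointD[OF disj, of A0 B] by blast
    then show ?thesis by (simp add: b_def w_def side_product_eq_0)
  qed
  \<comment> \<open>The coboundary of \<open>b\<close> is evaluated on a transversal of all
    \<open>s\<close> sides. It is 0 because \<open>b\<close> is itself a coboundary, yet it equals
    \<open>b vs = 1\<close>, since by \<open>b0\<close> every other term starts with
    \<open>rep A0\<close> and vanishes.\<close>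
  have "0 = wedge (\<lambda>_. 1) (wedge (\<lambda>_. 1) c) (rep A0 # vs)" by (simp only: wedge_self)
  also have "\<dots> = wedge (\<lambda>_. 1) b (rep A0 # vs)"
    using bc vs(2) by (intro wedge_cong[of "s - 1"]) auto
  also have "\<dots> = b vs" by (simp add: b0)
  also have "\<dots> = 1"
  proof -
    have "disjoint (set As)" using disj sides(2) by (auto simp: disjoint_def)
    then have "w vs = single (list_monomial vs) 1"
      using side_product_transversal[OF vs(1) sides(4)] by (simp add: w_def prod_list_Var)
    then show ?thesis by (simp add: b_def)
  qed
  finally show False by simp
qed

subsection \<open>Upper bounds for dimension and depth\<close>

text \<open>Gaussian elimination: a pivot \<open>x0\<close> with nonzero entry at \<open>y\<close>
  clears that equation, and its own coefficient is recovered at the end.\<close>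

lemma linear_dependence:
  fixes a :: "'x \<Rightarrow> 'y \<Rightarrow> 'k::field"
  assumes "finite Y" "finite X" "card Y < card X"
  shows "\<exists>c. (\<exists>x\<in>X. c x \<noteq> 0) \<and> (\<forall>y\<in>Y. (\<Sum>x\<in>X. c x * a x y) = 0)"
  using assms
proof (induction Y arbitrary: X a rule: finite_induct)
  case empty
  then have "X \<noteq> {}" by auto
  then show ?case by (intro exI[of _ "\<lambda>_. 1"]) auto
next
  case (insert y Y)
  show ?case
  proof (cases "\<forall>x\<in>X. a x y = 0")
    case True
    have "card Y < card X" using insert by simp
    then obtain c where "\<exists>x\<in>X. c x \<noteq> 0" "\<forall>y\<in>Y. (\<Sum>x\<in>X. c x * a x y) = 0"
      using insert.IH[OF \<open>finite X\<close>, of a] by blast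
    moreover have "(\<Sum>x\<in>X. c x * a x y) = 0" using True by simp
    ultimately show ?thesis by blast
  next
    case False
    then obtain x0 where x0: "x0 \<in> X" "a x0 y \<noteq> 0" by blast
    let ?X = "X - {x0}"
    define b where "b x z = a x z - a x y / a x0 y * a x0 z" for x z
    have "card Y < card ?X" using insert x0 by simp
    then obtain c where c: "\<exists>x\<in>?X. c x \<noteq> 0" "\<And>z. z \<in> Y \<Longrightarrow> (\<Sum>x\<in>?X. c x * b x z) = 0"
      using insert.IH[of ?X b] insert.prems by auto
    define d where "d x = (if x = x0 then - (\<Sum>x\<in>?X. c x * (a x y / a x0 y)) else c x)" for x
    have sum: "(\<Sum>x\<in>X. d x * a x z) = (\<Sum>x\<in>?X. c x * b x z)" for z
    proof -
      have "(\<Sum>x\<in>X. d x * a x z) = d x0 * a x0 z + (\<Sum>x\<in>?X. c x * a x z)"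
        using insert.prems x0 by (subst sum.remove[of _ x0]) (auto simp: d_def intro!: sum.cong)
      then show ?thesis
        by (simp add: d_def b_def right_diff_distrib sum_subtractf sum_distrib_right mult.assoc)
    qed
    have "b x y = 0" for x using x0 by (simp add: b_def)
    then have "\<forall>z\<in>insert y Y. (\<Sum>x\<in>X. d x * a x z) = 0" using c(2) by (auto simp: sum)
    moreover have "\<exists>x\<in>X. d x \<noteq> 0" using c(1) by (auto simp: d_def)
    ultimately show ?thesis by blast
  qed
qed

section \<open>Counting monomials with bounded exponents\<close>

definition exponents_le :: "nat \<Rightarrow> ('v, 'k::comm_ring_1) mpoly \<Rightarrow> bool" where
  "exponents_le M f \<longleftrightarrow> (\<forall>m\<in>keys f. \<forall>v. lookup m v \<le> M)"

lemma exponents_le_mult: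
  "exponents_le M f \<Longrightarrow> exponents_le N g \<Longrightarrow> exponents_le (M + N) (f * g)"
  using keys_mult[of f g] by (fastforce simp: exponents_le_def lookup_add intro: add_mono)

lemma exponents_le_mono: "exponents_le M f \<Longrightarrow> M \<le> N \<Longrightarrow> exponents_le N f"
  by (auto simp: exponents_le_def intro: order.trans)

lemma exponents_le_1: "exponents_le 0 1"
  by (simp add: exponents_le_def)

lemma exponents_le_power: "exponents_le M f \<Longrightarrow> exponents_le (n * M) (f ^ n)"
  by (induction n) (simp_all add: exponents_le_1 exponents_le_mult)

lemma exponents_le_power_product:
  assumes "\<forall>f\<in>set fs. exponents_le M f" "length a = length fs" "\<forall>i\<in>set a. i \<le> N"
  shows "exponents_le (length fs * (N * M)) (power_product fs a)"
  using assms
proof (induction fs arbitrary: a)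
  case Nil
  then show ?case by (simp add: exponents_le_1)
next
  case (Cons f fs)
  then obtain i b where a: "a = i # b" by (cases a) auto
  have "exponents_le (N * M) (f ^ i)"
    using Cons.prems a exponents_le_power[of M f i] by (auto intro: exponents_le_mono)
  moreover have "exponents_le (length fs * (N * M)) (power_product fs b)"
    using Cons.prems a by (intro Cons.IH) auto
  ultimately show ?case using exponents_le_mult by (fastforce simp: a)
qed

lemma exponents_le_exists: "\<exists>M. \<forall>f\<in>set fs. exponents_le M (f :: ('v::finite, 'k::comm_ring_1) mpoly)"
proof -
  define S where "S = (\<Union>f\<in>set fs. \<Union>m\<in>keys f. lookup m ` UNIV)"
  have "finite S" by (auto simp: S_def)
  then have "\<forall>f\<in>set fs. exponents_le (Max S) f"
    unfolding exponents_le_def by (auto simp: S_def intro!: Max_ge)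
  then show ?thesis by blast
qed

text \<open>A monomial is determined by its support and the exponents there. The point is that the
  degree in \<open>M\<close> is the maximal face size and not the number of variables.\<close>

lemma bounded_monomials:
  fixes \<Delta> :: "'v::finite set set" and M :: nat
  assumes "\<forall>F\<in>\<Delta>. card F \<le> D"
  defines "Y \<equiv> {m :: 'v \<Rightarrow>\<^sub>0 nat. keys m \<in> \<Delta> \<and> (\<forall>v. lookup m v \<le> M)}"
  shows "finite Y" "card Y \<le> card \<Delta> * Suc M ^ D"
proof -
  define Z where "Z F = {m :: 'v \<Rightarrow>\<^sub>0 nat. keys m = F \<and> (\<forall>v. lookup m v \<le> M)}" for F
  have Z: "finite (Z F) \<and> card (Z F) \<le> Suc M ^ D" if "F \<in> \<Delta>" for F
  proof -
    let ?E = "PiE F (\<lambda>_. {..M})"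
    let ?f = "\<lambda>m. restrict (lookup m) F"
    have inj: "inj_on ?f (Z F)"
    proof (rule inj_onI)
      fix m m' assume m: "m \<in> Z F" "m' \<in> Z F" and eq: "?f m = ?f m'"
      show "m = m'"
      proof (rule poly_mapping_eqI)
        fix v
        show "lookup m v = lookup m' v"
        proof (cases "v \<in> F")
          case True
          then show ?thesis using fun_cong[OF eq, of v] by simp
        next
          case False
          then have "v \<notin> keys m" "v \<notin> keys m'" using m by (auto simp: Z_def)
          then show ?thesis by (simp add: in_keys_iff)
        qed
      qed
    qed
    have sub: "?f ` Z F \<subseteq> ?E" by (auto simp: Z_def)
    have fin: "finite ?E" by (intro finite_PiE) auto
    have "card (Z F) \<le> card ?E" by (rule card_inj_on_le[OF inj sub fin])
    also have "\<dots> = Suc M ^ card F" by (simp add: card_PiE)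
    also have "\<dots> \<le> Suc M ^ D" using assms(1) that by (intro power_increasing) auto
    finally show ?thesis using inj_on_finite[OF inj sub fin] by simp
  qed
  have Y: "Y = (\<Union>F\<in>\<Delta>. Z F)" by (auto simp: Y_def Z_def)
  show "finite Y" using Z unfolding Y by (intro finite_UN_I) auto
  have "card Y \<le> (\<Sum>F\<in>\<Delta>. card (Z F))" unfolding Y by (intro card_UN_le) auto
  also have "\<dots> \<le> (\<Sum>F\<in>\<Delta>. Suc M ^ D)" using Z by (intro sum_mono) auto
  finally show "card Y \<le> card \<Delta> * Suc M ^ D" by simp
qed

text \<open>Counting: the \<open>N\<^sup>D\<^sup>+\<^sup>1\<close> power products with exponents below \<open>N\<close> lie, modulo the ideal, in a
  space whose dimension grows only like \<open>N\<^sup>D\<close>.\<close>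

lemma algebraic_dependence:
  fixes \<Delta> :: "'v::finite set set" and fs :: "('v, 'k::field) mpoly list"
  assumes \<Delta>: "\<forall>F\<in>\<Delta>. card F \<le> D" and len: "length fs = Suc D"
  shows "\<exists>X c. finite X \<and> (\<forall>a\<in>X. length a = length fs) \<and> (\<exists>a\<in>X. c a \<noteq> 0) \<and>
    (\<Sum>a\<in>X. single 0 (c a) * power_product fs a) \<in> face_ideal \<Delta>"
proof -
  obtain e where e: "\<forall>f\<in>set fs. exponents_le e f" using exponents_le_exists by blast
  \<comment> \<open>\<open>B\<close> is chosen so that \<open>Suc M <= B * N\<close>, whence at most
    \<open>card \<Delta> * B ^ D * N ^ D\<close> monomials of \<open>Y\<close> occur.
    \<open>N\<close> exceeds the constant factor, so this is less than the number
    \<open>N ^ Suc D\<close> of exponent lists.\<close>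
  define B where "B = Suc (Suc D * e)"
  define N where "N = Suc (card \<Delta> * B ^ D)"
  define M where "M = length fs * (N * e)"
  define X where "X = {a :: nat list. set a \<subseteq> {..<N} \<and> length a = length fs}"
  define Y where "Y = {m :: 'v \<Rightarrow>\<^sub>0 nat. keys m \<in> \<Delta> \<and> (\<forall>v. lookup m v \<le> M)}"
  have X: "finite X" "card X = N ^ Suc D"
    using finite_lists_length_eq[of "{..<N}"] card_lists_length_eq[of "{..<N}"]
    by (simp_all add: X_def len)
  have Y: "finite Y" "card Y \<le> card \<Delta> * Suc M ^ D"
    unfolding Y_def using bounded_monomials[OF \<Delta>] by auto
  have "Suc M \<le> B * N" by (simp add: M_def B_def len N_def algebra_simps)
  then have "Suc M ^ D \<le> (B * N) ^ D" by (intro power_mono) auto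
  then have "card \<Delta> * Suc M ^ D \<le> card \<Delta> * (B * N) ^ D" by (rule mult_le_mono2)
  also have "\<dots> = (card \<Delta> * B ^ D) * N ^ D" by (simp add: power_mult_distrib)
  also have "\<dots> < N * N ^ D" by (simp add: N_def)
  finally have "card Y < card X" using Y(2) X(2) by simp
  from linear_dependence[OF Y(1) X(1) this, of "\<lambda>a m. lookup (power_product fs a) m"]
  obtain c where c: "\<exists>a\<in>X. c a \<noteq> 0"
    "\<And>m. m \<in> Y \<Longrightarrow> (\<Sum>a\<in>X. c a * lookup (power_product fs a) m) = 0" by blast
  define g where "g = (\<Sum>a\<in>X. single 0 (c a) * power_product fs a)"
  have "lookup (single 0 k * f) m = k * lookup f m" for k m and f :: "('v, 'k) mpoly"
    using lookup_single_mult[of 0 k f m] by simp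
  then have g: "lookup g m = (\<Sum>a\<in>X. c a * lookup (power_product fs a) m)" for m
    by (simp add: g_def lookup_sum)
  have "lookup g m = 0" if "keys m \<in> \<Delta>" for m
  proof (cases "m \<in> Y")
    case True
    then show ?thesis by (simp add: g c(2))
  next
    case False
    then have "\<not> (\<forall>v. lookup m v \<le> M)" using that by (simp add: Y_def)
    have "m \<notin> keys (power_product fs a)" if "a \<in> X" for a
    proof -
      have "exponents_le M (power_product fs a)"
        unfolding M_def using that e by (intro exponents_le_power_product) (auto simp: X_def)
      then show ?thesis using \<open>\<not> (\<forall>v. lookup m v \<le> M)\<close> by (auto simp: exponents_le_def)
    qed
    then show ?thesis by (simp add: g in_keys_iff)
  qed
  then have "g \<in> face_ideal \<Delta>" by (auto simp: face_ideal_def in_keys_iff)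
  then show ?thesis using X(1) c(1) unfolding g_def by (intro exI[of _ X] exI[of _ c]) (auto simp: X_def)
qed

text \<open>The common source of the bounds on dimension and depth. Working over a field makes the
  nonzero coefficients of the relation units, as \<open>algebraic_dependence_chain\<close>
  demands.\<close>

lemma chain_in_face_ring:
  fixes \<Delta> :: "'v::finite set set" and fs :: "('v, 'k::field) mpoly list"
  assumes \<Delta>: "\<forall>F\<in>\<Delta>. card F \<le> D" and len: "length fs = Suc D"
    and J: "\<And>i. i \<le> length fs \<Longrightarrow> is_ideal (J i)" "face_ideal \<Delta> \<subseteq> J 0"
      "\<And>i. i < length fs \<Longrightarrow> J i \<subseteq> J (Suc i)" "\<And>i. i < length fs \<Longrightarrow> fs ! i \<in> J (Suc i)"
      "\<And>i g. i < length fs \<Longrightarrow> fs ! i * g \<in> J i \<Longrightarrow> g \<in> J i"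
  shows "1 \<in> J (Suc D)"
proof -
  obtain X c where X: "finite X" "\<forall>a\<in>X. length a = length fs" "\<exists>a\<in>X. c a \<noteq> 0"
    and rel: "(\<Sum>a\<in>X. single 0 (c a) * power_product fs a) \<in> face_ideal \<Delta>"
    using algebraic_dependence[OF \<Delta> len] by (elim exE conjE) (rule that)
  define C where "C a = (single 0 (c a) :: ('v, 'k) mpoly)" for a
  have "1 \<in> J (length fs)"
  proof (rule algebraic_dependence_chain[where X = X and c = C])
    show "C a dvd 1" if "C a \<noteq> 0" for a
    proof -
      have "c a \<noteq> 0" using that by (auto simp: C_def)
      then have "1 = C a * single 0 (1 / c a)"
        by (simp add: C_def mult_single)
      then show ?thesis by (rule dvdI)
    qed
    show "\<exists>a\<in>X. C a \<noteq> 0"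
      using X(3) unfolding C_def by (metis lookup_single_eq lookup_zero)
    show "(\<Sum>a\<in>X. C a * power_product fs a) \<in> J 0"
      using rel J(2) by (auto simp: C_def)
  qed (use X J in auto)
  then show ?thesis by (simp add: len)
qed

lemma krull_dim_face_ideal_le:
  fixes \<Delta> :: "'v::finite set set"
  assumes \<Delta>: "\<forall>F\<in>\<Delta>. card F \<le> D"
  shows "krull_dim_quot (face_ideal \<Delta> :: ('v, 'k::field) mpoly set) \<le> enat D"
  unfolding krull_dim_quot_def
proof (rule Sup_least, elim CollectE exE conjE)
  fix d n and p :: "nat \<Rightarrow> ('v, 'k) mpoly set"
  assume d: "d = enat n" and p: "\<forall>i\<le>n. is_prime_ideal (p i) \<and> face_ideal \<Delta> \<subseteq> p i"
    and inc: "\<forall>i<n. p i \<subset> p (Suc i)"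
  have "n \<le> D"
  proof (rule ccontr)
    assume "\<not> n \<le> D"
    then have n: "Suc D \<le> n" by simp
    have sub: "p i \<subseteq> p (Suc i)" if "i < n" for i using inc that by blast
    \<comment> \<open>An element of \<open>p (Suc i)\<close> outside the prime \<open>p i\<close> is
      a nonzerodivisor modulo \<open>p i\<close>.\<close>
    have "\<exists>f. f \<in> p (Suc i) \<and> f \<notin> p i" if "i < n" for i using inc that by blast
    then obtain f where f: "\<And>i. i < n \<Longrightarrow> f i \<in> p (Suc i) \<and> f i \<notin> p i" by metis
    let ?fs = "map f [0..<Suc D]"
    have "1 \<in> p (Suc D)"
    proof (rule chain_in_face_ring[OF \<Delta>, where fs = ?fs])
      show "g \<in> p i" if "i < length ?fs" "?fs ! i * g \<in> p i" for i g
      proof -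
        have "is_prime_ideal (p i)" using p that n by auto
        moreover have "f i \<notin> p i" "f i * g \<in> p i" using that f[of i] n by (auto simp del: upt_Suc)
        ultimately show ?thesis by (auto simp: is_prime_ideal_def)
      qed
      show "p i \<subseteq> p (Suc i)" if "i < length ?fs" for i using that n by (intro sub) simp
    qed (use p n f in \<open>auto simp: is_prime_ideal_def simp del: upt_Suc\<close>)
    moreover have "is_ideal (p (Suc D))" "p (Suc D) \<noteq> UNIV"
      using p n by (auto simp: is_prime_ideal_def)
    ultimately show False using ideal_eq_UNIV by blast
  qed
  then show "d \<le> enat D" using d by simp
qed

lemma depth_face_ideal_le:
  fixes \<Delta> :: "'v::finite set set"
  assumes down: "down_closed \<Delta>" and \<Delta>: "\<forall>F\<in>\<Delta>. card F \<le> D"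
  shows "depth_quot m (face_ideal \<Delta> :: ('v, 'k::field) mpoly set) \<le> enat D"
  unfolding depth_quot_def
proof (rule Sup_least, elim CollectE exE conjE)
  fix d and fs :: "('v, 'k) mpoly list"
  assume d: "d = enat (length fs)" and reg: "regular_seq_quot m (face_ideal \<Delta>) fs"
  let ?J = "\<lambda>i. ideal_gen (face_ideal \<Delta> \<union> set (take i fs)) :: ('v, 'k) mpoly set"
  have "length fs \<le> D"
  proof (rule ccontr)
    assume "\<not> length fs \<le> D"
    then have len: "Suc D \<le> length fs" by simp
    have "1 \<in> ?J (Suc D)"
    proof (rule chain_in_face_ring[OF \<Delta>, where fs = "take (Suc D) fs"])
      show "face_ideal \<Delta> \<subseteq> ?J 0" using ideal_gen_superset by auto
      show "?J i \<subseteq> ?J (Suc i)" for i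
        using set_take_subset_set_take[of i "Suc i" fs] by (intro ideal_gen_mono) auto
      show "take (Suc D) fs ! i \<in> ?J (Suc i)" if "i < length (take (Suc D) fs)" for i
      proof -
        have "fs ! i \<in> set (take (Suc i) fs)" using that by (simp add: take_Suc_conv_app_nth)
        then have "fs ! i \<in> ?J (Suc i)" by (intro subsetD[OF ideal_gen_superset]) simp
        then show ?thesis using that by simp
      qed
      show "g \<in> ?J i" if "i < length (take (Suc D) fs)" "take (Suc D) fs ! i * g \<in> ?J i" for i g
        using reg that len by (auto simp: regular_seq_quot_def)
    qed (use len in \<open>auto simp: is_ideal_ideal_gen\<close>)
    moreover have "?J (Suc D) \<subseteq> ideal_gen (face_ideal \<Delta> \<union> set fs)"
      using set_take_subset[of "Suc D" fs] by (intro ideal_gen_mono) auto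
    ultimately show False
      using reg ideal_eq_UNIV[OF is_ideal_ideal_gen] by (auto simp: regular_seq_quot_def)
  qed
  then show "d \<le> enat D" using d by simp
qed

subsection \<open>Lower bound for the dimension\<close>

text \<open>The extremal pair is found by maximizing one exponent after the other, as for a
  lexicographic order.\<close>

lemma unique_sum:
  fixes A B :: "('v::finite \<Rightarrow>\<^sub>0 nat) set"
  assumes fin: "finite A" "finite B" and ne: "A \<noteq> {}" "B \<noteq> {}"
  shows "\<exists>a\<in>A. \<exists>b\<in>B. \<forall>a'\<in>A. \<forall>b'\<in>B. a' + b' = a + b \<longrightarrow> a' = a \<and> b' = b"
proof -
  \<comment> \<open>Invariant: \<open>A'\<close> and \<open>B'\<close> are nonempty, constant on the
    coordinates treated so far, and no sum of elements of \<open>A'\<close> and \<open>B'\<close>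
    arises from a pair outside them. Maximizing a further coordinate preserves this, as a sum of two
    maxima is attained only by two maximizers.\<close>
  let ?good = "\<lambda>S A' B'. A' \<subseteq> A \<and> B' \<subseteq> B \<and> A' \<noteq> {} \<and> B' \<noteq> {} \<and>
      (\<forall>a\<in>A'. \<forall>a'\<in>A'. \<forall>v\<in>S. lookup a v = lookup a' v) \<and>
      (\<forall>b\<in>B'. \<forall>b'\<in>B'. \<forall>v\<in>S. lookup b v = lookup b' v) \<and>
      (\<forall>a\<in>A. \<forall>b\<in>B. \<forall>a'\<in>A'. \<forall>b'\<in>B'. a + b = a' + b' \<longrightarrow> a \<in> A' \<and> b \<in> B')"
  have "\<exists>A' B'. ?good S A' B'" if "finite S" for S :: "'v set"
    using that
  proof (induction S rule: finite_induct)
    case empty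
    show ?case using ne by (intro exI[of _ A] exI[of _ B]) auto
  next
    case (insert x S)
    from insert.IH obtain A' B' where good: "?good S A' B'" by (elim exE) (rule that)
    have sub: "A' \<subseteq> A" "B' \<subseteq> B" "A' \<noteq> {}" "B' \<noteq> {}" using good by - (elim conjE, assumption)+
    have agree: "\<forall>a\<in>A'. \<forall>a'\<in>A'. \<forall>v\<in>S. lookup a v = lookup a' v"
        "\<forall>b\<in>B'. \<forall>b'\<in>B'. \<forall>v\<in>S. lookup b v = lookup b' v"
      using good by - (elim conjE, assumption)+
    have closed: "\<forall>a\<in>A. \<forall>b\<in>B. \<forall>a'\<in>A'. \<forall>b'\<in>B'. a + b = a' + b' \<longrightarrow> a \<in> A' \<and> b \<in> B'"
      using good by - (elim conjE, assumption)
    define mA where "mA = Max ((\<lambda>a. lookup a x) ` A')"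
    define mB where "mB = Max ((\<lambda>b. lookup b x) ` B')"
    let ?A = "{a \<in> A'. lookup a x = mA}" and ?B = "{b \<in> B'. lookup b x = mB}"
    have fin': "finite A'" "finite B'" using sub fin finite_subset by auto
    have "mA \<in> (\<lambda>a. lookup a x) ` A'" "mB \<in> (\<lambda>b. lookup b x) ` B'"
      unfolding mA_def mB_def using fin' sub by (intro Max_in; simp)+
    then have "?A \<noteq> {}" "?B \<noteq> {}" by auto
    moreover have "a \<in> ?A \<and> b \<in> ?B"
      if "a \<in> A" "b \<in> B" "a' \<in> ?A" "b' \<in> ?B" "a + b = a' + b'" for a b a' b'
    proof -
      have ab: "a \<in> A' \<and> b \<in> B'" using closed that by blast
      then have "lookup a x \<le> mA" "lookup b x \<le> mB"
        unfolding mA_def mB_def using fin' by auto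
      moreover have "lookup a x + lookup b x = mA + mB"
        using arg_cong[OF that(5), of "\<lambda>m. lookup m x"] that(3,4) by (simp add: lookup_add)
      ultimately show ?thesis using ab by auto
    qed
    moreover have "?A \<subseteq> A" "?B \<subseteq> B" using sub by auto
    moreover have "\<forall>a\<in>?A. \<forall>a'\<in>?A. \<forall>v\<in>insert x S. lookup a v = lookup a' v"
      "\<forall>b\<in>?B. \<forall>b'\<in>?B. \<forall>v\<in>insert x S. lookup b v = lookup b' v"
      using agree by auto
    moreover from calculation(3) have
      "\<forall>a\<in>A. \<forall>b\<in>B. \<forall>a'\<in>?A. \<forall>b'\<in>?B. a + b = a' + b' \<longrightarrow> a \<in> ?A \<and> b \<in> ?B"
      by (intro ballI impI) blast
    ultimately have "?good (insert x S) ?A ?B" by - (intro conjI; assumption)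
    then show ?case by (intro exI)
  qed
  from this[OF finite[of UNIV]] obtain A' B' where good: "?good UNIV A' B'" by (elim exE) (rule that)
  have sub: "A' \<subseteq> A" "B' \<subseteq> B" "A' \<noteq> {}" "B' \<noteq> {}" using good by - (elim conjE, assumption)+
  have agree: "\<forall>a\<in>A'. \<forall>a'\<in>A'. \<forall>v\<in>UNIV. lookup a v = lookup a' v"
      "\<forall>b\<in>B'. \<forall>b'\<in>B'. \<forall>v\<in>UNIV. lookup b v = lookup b' v"
    using good by - (elim conjE, assumption)+
  have closed: "\<forall>a\<in>A. \<forall>b\<in>B. \<forall>a'\<in>A'. \<forall>b'\<in>B'. a + b = a' + b' \<longrightarrow> a \<in> A' \<and> b \<in> B'"
    using good by - (elim conjE, assumption)
  obtain a b where ab: "a \<in> A'" "b \<in> B'" using sub by blast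
  have "a' = a" if "a' \<in> A'" for a' using agree(1) ab that by (auto intro: poly_mapping_eqI)
  moreover have "b' = b" if "b' \<in> B'" for b' using agree(2) ab that by (auto intro: poly_mapping_eqI)
  ultimately show ?thesis using ab sub closed by (meson subsetD)
qed

lemma lookup_mult_unique:
  fixes f g :: "('v, 'k::comm_ring_1) mpoly"
  assumes "\<And>p q. p \<in> keys f \<Longrightarrow> q \<in> keys g \<Longrightarrow> p + q = a + b \<Longrightarrow> p = a \<and> q = b"
  shows "lookup (f * g) (a + b) = lookup f a * lookup g b"
proof -
  have "f * g = (\<Sum>p\<in>keys f. single p (lookup f p)) * g" by (simp add: sum_monomials)
  then have "lookup (f * g) (a + b) = (\<Sum>p\<in>keys f. lookup (single p (lookup f p) * g) (a + b))"
    by (simp add: sum_distrib_right lookup_sum)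
  also have "\<dots> = (\<Sum>p\<in>keys f. if p = a then lookup f a * lookup g b else 0)"
  proof (intro sum.cong refl)
    fix p assume p: "p \<in> keys f"
    show "lookup (single p (lookup f p) * g) (a + b) = (if p = a then lookup f a * lookup g b else 0)"
    proof (cases "p = a")
      case True
      then show ?thesis by (simp add: lookup_single_mult)
    next
      case False
      then have "a + b \<notin> (+) p ` keys g" using assms[OF p] by fastforce
      then have "a + b \<notin> keys (single p (lookup f p) * g)" using keys_single_mult by blast
      then show ?thesis using False by (simp add: in_keys_iff)
    qed
  qed
  also have "\<dots> = lookup f a * lookup g b" by (simp add: in_keys_iff)
  finally show ?thesis .
qed

section \<open>Prime ideals from simplices\<close>

lemma down_closed_Pow: "down_closed (Pow F)"
  by (auto simp: down_closed_def)

text \<open>The quotient is the polynomial ring in the variables of \<open>F\<close>. It is a domain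
  because, by \<open>unique_sum\<close>, some monomial of a product of two nonzero elements arises
  from a single pair and cannot cancel.\<close>

lemma is_prime_ideal_face_ideal_Pow:
  "is_prime_ideal (face_ideal (Pow F) :: ('v::finite, 'k::field) mpoly set)"
  unfolding is_prime_ideal_def
proof (intro conjI allI impI)
  show "is_ideal (face_ideal (Pow F) :: ('v, 'k) mpoly set)"
    by (rule is_ideal_face_ideal[OF down_closed_Pow])
  have "1 \<notin> (face_ideal (Pow F) :: ('v, 'k) mpoly set)" by (simp add: face_ideal_def)
  then show "(face_ideal (Pow F) :: ('v, 'k) mpoly set) \<noteq> UNIV" by blast
  fix f g :: "('v, 'k) mpoly"
  assume fg: "f * g \<in> face_ideal (Pow F)"
  let ?A = "{m \<in> keys f. keys m \<subseteq> F}" and ?B = "{m \<in> keys g. keys m \<subseteq> F}"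
  show "f \<in> face_ideal (Pow F) \<or> g \<in> face_ideal (Pow F)"
  proof (rule ccontr)
    assume "\<not> (f \<in> face_ideal (Pow F) \<or> g \<in> face_ideal (Pow F))"
    then have "?A \<noteq> {}" "?B \<noteq> {}" by (auto simp: face_ideal_def)
    then obtain a b where ab: "a \<in> ?A" "b \<in> ?B"
      and uniq: "\<forall>a'\<in>?A. \<forall>b'\<in>?B. a' + b' = a + b \<longrightarrow> a' = a \<and> b' = b"
      using unique_sum[of ?A ?B] by auto
    have "lookup (f * g) (a + b) = lookup f a * lookup g b"
    proof (rule lookup_mult_unique)
      fix p q assume pq: "p \<in> keys f" "q \<in> keys g" "p + q = a + b"
      have "keys p \<union> keys q = keys a \<union> keys b"
        using arg_cong[OF pq(3), of keys] by (simp add: keys_plus_nat)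
      then have "p \<in> ?A" "q \<in> ?B" using pq ab by auto
      then show "p = a \<and> q = b" using uniq pq(3) by blast
    qed
    then have "a + b \<in> keys (f * g)" using ab by (simp add: in_keys_iff)
    moreover have "keys (a + b) \<subseteq> F" using ab by (simp add: keys_plus_nat)
    ultimately show False using fg by (auto simp: face_ideal_def)
  qed
qed

lemma krull_dim_face_ideal_ge:
  fixes \<Delta> :: "'v::finite set set"
  assumes "down_closed \<Delta>" "F \<in> \<Delta>"
  shows "enat (card F) \<le> krull_dim_quot (face_ideal \<Delta> :: ('v, 'k::field) mpoly set)"
  unfolding krull_dim_quot_def
proof (rule Sup_upper, rule CollectI)
  obtain xs where xs: "set xs = F" "distinct xs" using finite_distinct_list[of F] by auto
  then have len: "length xs = card F" by (metis distinct_card)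
  \<comment> \<open>Dropping one vertex from the simplex adds its variable to the prime, so a face
    with n vertices gives n strict inclusions.\<close>
  let ?p = "\<lambda>i. face_ideal (Pow (set (drop i xs))) :: ('v, 'k) mpoly set"
  have "is_prime_ideal (?p i) \<and> face_ideal \<Delta> \<subseteq> ?p i" for i
    using set_drop_subset[of i xs] assms xs
    by (intro conjI is_prime_ideal_face_ideal_Pow face_ideal_antimono) (auto simp: down_closed_def)
  moreover have "?p i \<subset> ?p (Suc i)" if "i < card F" for i
  proof -
    have drop: "drop i xs = xs ! i # drop (Suc i) xs" using that by (simp add: Cons_nth_drop_Suc len)
    then have "xs ! i \<notin> set (drop (Suc i) xs)" using xs(2) by (metis distinct.simps(2) distinct_drop)
    then have "Var (xs ! i) \<in> ?p (Suc i)" by (auto simp: Var_def face_ideal_def)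
    moreover have "Var (xs ! i) \<notin> ?p i" by (simp add: drop Var_def face_ideal_def)
    moreover have "?p i \<subseteq> ?p (Suc i)" by (intro face_ideal_antimono) (auto simp: drop)
    ultimately show ?thesis by blast
  qed
  ultimately show "\<exists>n. enat (card F) = enat n \<and> (\<exists>p :: nat \<Rightarrow> ('v, 'k) mpoly set.
      (\<forall>i\<le>n. is_prime_ideal (p i) \<and> face_ideal \<Delta> \<subseteq> p i) \<and> (\<forall>i<n. p i \<subset> p (Suc i)))"
    by (intro exI[of _ "card F"] conjI refl exI[of _ ?p]) auto
qed

subsection \<open>The Cohen--Macaulay property\<close>

lemma is_ideal_max_ideal: "is_ideal max_ideal"
  by (simp add: max_ideal_def is_ideal_ideal_gen)

text \<open>The right-hand side consists of the polynomials without constant term, visibly a proper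
  ideal; this supplies the properness in \<open>regular_seq_quot\<close>.\<close>

lemma max_ideal_subset: "max_ideal \<subseteq> (face_ideal {{}} :: ('v, 'k::comm_ring_1) mpoly set)"
  unfolding max_ideal_def
  by (intro ideal_gen_least is_ideal_face_ideal) (auto simp: down_closed_def face_ideal_def Var_def simp del: keys_eq_empty)

lemma esym_in_max_ideal:
  assumes "0 < k"
  shows "(esym (A :: 'v::finite set) k :: ('v, 'k::comm_ring_1) mpoly) \<in> max_ideal"
  unfolding esym_def
proof (rule ideal_sum[OF is_ideal_max_ideal])
  fix S assume "S \<in> {S. S \<subseteq> A \<and> card S = k}"
  then have "S \<noteq> {}" using assms by auto
  then obtain x where "x \<in> S" by blast
  then have "sqfree_monomial S = Var x * (\<Prod>v\<in>S - {x}. Var v :: ('v, 'k) mpoly)"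
    by (simp add: sqfree_monomial_def prod.remove)
  moreover have "Var x \<in> (max_ideal :: ('v, 'k) mpoly set)"
    unfolding max_ideal_def by (rule subsetD[OF ideal_gen_superset]) simp
  ultimately show "(sqfree_monomial S :: ('v, 'k) mpoly) \<in> max_ideal"
    by (simp add: ideal_mult_right is_ideal_max_ideal)
qed

lemma cohen_macaulay_skeleton:
  fixes U :: "'v::finite set"
  assumes r: "r \<le> card U"
  shows "cohen_macaulay (face_ideal (skeleton U r) :: ('v, 'k::field) mpoly set)"
proof -
  let ?J = "face_ideal (skeleton U r) :: ('v, 'k) mpoly set"
  let ?E = "map (esym UNIV) [1..<Suc r] :: ('v, 'k) mpoly list"
  have faces: "\<forall>F\<in>skeleton U r. card F \<le> r" by (simp add: skeleton_def)
  have max: "set ?E \<subseteq> max_ideal" by (auto intro!: esym_in_max_ideal simp del: upt_Suc)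
  have "is_ideal (face_ideal {{}} :: ('v, 'k) mpoly set)"
    by (simp add: is_ideal_face_ideal down_closed_def)
  moreover have "?J \<subseteq> face_ideal {{}}"
    by (intro face_ideal_antimono) (simp add: skeleton_def)
  ultimately have "ideal_gen (?J \<union> set ?E) \<subseteq> face_ideal {{}}"
    using max max_ideal_subset by (intro ideal_gen_least) auto
  moreover have "1 \<notin> (face_ideal {{}} :: ('v, 'k) mpoly set)" by (simp add: face_ideal_def)
  ultimately have "ideal_gen (?J \<union> set ?E) \<noteq> UNIV" by blast
  then have "regular_seq_quot max_ideal ?J ?E"
    using max weakly_regular_skeleton[OF r]
    by (simp add: regular_seq_quot_iff is_ideal_face_ideal down_closed_skeleton del: upt_Suc)
  then have "enat (length ?E) \<le> depth_quot max_ideal ?J"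
    unfolding depth_quot_def by (intro Sup_upper) blast
  then have "enat r \<le> depth_quot max_ideal ?J" by (simp del: upt_Suc)
  then have depth: "depth_quot max_ideal ?J = enat r"
    by (intro antisym depth_face_ideal_le down_closed_skeleton faces)
  obtain F where F: "F \<subseteq> U" "card F = r" using r by (meson obtain_subset_with_card_n)
  then have "enat r \<le> krull_dim_quot ?J"
    using krull_dim_face_ideal_ge[OF down_closed_skeleton, of F U r] by (simp add: skeleton_def)
  then have "krull_dim_quot ?J = enat r"
    by (intro antisym krull_dim_face_ideal_le faces)
  then show ?thesis using depth by (simp add: cohen_macaulay_def)
qed

lemma cohen_macaulay_imp_one_balanced:
  fixes P :: "'v::finite set set"
  assumes cump: "complete_uniform_multipartite P s H" and s: "2 \<le> s" "s \<le> card P"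
    and CM: "cohen_macaulay (face_ideal (independence_complex H) :: ('v, 'k::field) mpoly set)"
  shows "one_balanced P"
proof (rule ccontr)
  let ?I = "face_ideal (independence_complex H) :: ('v, 'k) mpoly set"
  have P: "partition_on UNIV P" using cump by (simp add: complete_uniform_multipartite_def)
  have pos: "0 < card A" if "A \<in> P" for A
    using that P by (auto simp: partition_on_def card_gt_0_iff)
  assume "\<not> one_balanced P"
  then obtain A where A: "A \<in> P" "card A \<noteq> 1" by (auto simp: one_balanced_def)
  \<comment> \<open>The oversized side \<open>A\<close> has to be among the \<open>s - 1\<close>
    chosen sides; \<open>s - 2\<close> others complete it.\<close>
  have "s - 2 \<le> card (P - {A})" using A s by simp
  then obtain Q where Q: "Q \<subseteq> P - {A}" "card Q = s - 2" by (meson obtain_subset_with_card_n)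
  let ?Q = "insert A Q"
  have QP: "?Q \<subseteq> P" and "finite ?Q" and cardQ: "card ?Q = s - 1"
    using Q A s by (auto simp: card_insert_if)
  have disj: "A \<inter> B = {}" if "A \<in> P" "B \<in> P" "A \<noteq> B" for A B
    using P that disjointD[of P A B] by (auto simp: partition_on_def)
  have "card ?Q = (\<Sum>B\<in>?Q. 1)" by simp
  also have "\<dots> < (\<Sum>B\<in>?Q. card B)"
  proof (rule sum_strict_mono_ex1)
    show "\<forall>B\<in>?Q. 1 \<le> card B" using pos QP by (auto simp: Suc_le_eq)
    show "\<exists>B\<in>?Q. 1 < card B" using pos[OF A(1)] A(2) by (intro bexI[of _ A]) auto
  qed simp
  also have "\<dots> = card (\<Union>?Q)"
    using disj QP by (intro card_Union_disjoint[symmetric]) (auto simp: pairwise_def disjnt_def)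
  finally have large: "s - 1 < card (\<Union>?Q)" using cardQ by simp
  have "{B \<in> P. \<Union>?Q \<inter> B \<noteq> {}} \<subseteq> ?Q"
    using disj QP by blast
  then have "card {B \<in> P. \<Union>?Q \<inter> B \<noteq> {}} \<le> s - 1"
    using card_mono[OF \<open>finite ?Q\<close>] cardQ by metis
  then have "\<Union>?Q \<in> independence_complex H"
    using s unfolding multipartite_face_iff[OF cump] by linarith
  then have "enat (card (\<Union>?Q)) \<le> krull_dim_quot ?I"
    by (rule krull_dim_face_ideal_ge[OF down_closed_independence_complex])
  moreover have "depth_quot max_ideal ?I \<le> enat (s - 1)"
    unfolding depth_quot_def
  proof (rule Sup_least, elim CollectE exE conjE)
    fix d and fs :: "('v, 'k) mpoly list"
    assume d: "d = enat (length fs)" and fs: "regular_seq_quot max_ideal ?I fs"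
    have "is_ideal ?I" by (rule is_ideal_face_ideal[OF down_closed_independence_complex])
    then have "length fs < s"
      using fs s by (intro multipartite_regular_sequence_length[OF cump]) (auto simp: regular_seq_quot_iff)
    then show "d \<le> enat (s - 1)" using d by simp
  qed
  ultimately have "enat (card (\<Union>?Q)) \<le> enat (s - 1)"
    using CM unfolding cohen_macaulay_def by (metis order.trans)
  then show False using large by simp
qed

lemma one_balanced_skeleton:
  fixes P :: "'v::finite set set"
  assumes "complete_uniform_multipartite P s H" "one_balanced P" "1 \<le> s"
  shows "independence_complex H = skeleton UNIV (s - 1)" "card P = card (UNIV :: 'v set)"
proof -
  have P: "partition_on UNIV P" using assms by (simp add: complete_uniform_multipartite_def)
  have PE: "P = range (\<lambda>v. {v})"
  proof (intro equalityI subsetI)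
    show "A \<in> range (\<lambda>v. {v})" if "A \<in> P" for A
      using that assms(2) by (auto simp: one_balanced_def card_1_singleton_iff)
    show "A \<in> P" if A: "A \<in> range (\<lambda>v. {v})" for A
    proof -
      obtain v where v: "A = {v}" using A by blast
      have "v \<in> \<Union>P" using P by (auto simp: partition_on_def)
      then obtain B where "B \<in> P" "v \<in> B" by blast
      moreover from this have "B = {v}"
        using assms(2) by (auto simp: one_balanced_def card_1_singleton_iff)
      ultimately show ?thesis using v by simp
    qed
  qed
  then show "card P = card (UNIV :: 'v set)" by (simp add: card_image)
  have "{A \<in> P. F \<inter> A \<noteq> {}} = (\<lambda>v. {v}) ` F" for F by (auto simp: PE)
  then have "card {A \<in> P. F \<inter> A \<noteq> {}} = card F" for F by (simp add: card_image)
  then show "independence_complex H = skeleton UNIV (s - 1)"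
    using multipartite_face_iff[OF assms(1)] assms(3) by (auto simp: skeleton_def)
qed

lemma restrict_skeleton: "restrict_complex (skeleton V r) U = skeleton (V \<inter> U) r"
  by (auto simp: restrict_complex_def skeleton_def)

lemma cdim_skeleton: "cdim (skeleton (U :: 'v::finite set) r) = int (min r (card U)) - 1"
proof -
  have "Max (card ` skeleton U r) = min r (card U)"
  proof (rule Max_eqI)
    show "y \<le> min r (card U)" if "y \<in> card ` skeleton U r" for y
      using that by (auto simp: skeleton_def intro: card_mono)
    obtain F where "F \<subseteq> U" "card F = min r (card U)"
      by (meson min.cobounded2 obtain_subset_with_card_n)
    then show "min r (card U) \<in> card ` skeleton U r"
      by (intro image_eqI[of _ _ F]) (auto simp: skeleton_def)
  qed simp
  then show ?thesis by (simp add: cdim_def)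
qed

theorem theorem3p7:
  fixes P :: "('v::finite) set set" and H :: "'v set set" and s t l :: nat
  assumes "complete_uniform_multipartite P s H"
    and "t = card P"
    and "2 \<le> s" and "s \<le> t"
    and "1 \<le> l"
  shows "(l_cohen_macaulay TYPE('k::field) l (independence_complex H)
            \<longleftrightarrow> one_balanced P \<and> l \<le> t - s + 2)
         \<and> (cohen_macaulay (edge_ideal H :: ('v, 'k) mpoly set)
            \<longleftrightarrow> l_cohen_macaulay TYPE('k) 2 (independence_complex H))"
proof -
  let ?\<Delta> = "independence_complex H"
  have SR: "stanley_reisner_ideal (restrict_complex ?\<Delta> UNIV) = (edge_ideal H :: ('v, 'k) mpoly set)"
    by (simp add: restrict_complex_def stanley_reisner_ideal_eq down_closed_independence_complex edge_ideal_eq)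
  have CM: "cohen_macaulay (edge_ideal H :: ('v, 'k) mpoly set)"
    if "1 \<le> k" "l_cohen_macaulay TYPE('k) k ?\<Delta>" for k
    using that SR by (auto simp: l_cohen_macaulay_def dest!: spec[of _ "{}"])
  have balanced: "one_balanced P" if "cohen_macaulay (edge_ideal H :: ('v, 'k) mpoly set)"
    using that assms(2-4)
    by (intro cohen_macaulay_imp_one_balanced[OF assms(1), where 'k = 'k]) (auto simp: edge_ideal_eq)
  have iff: "l_cohen_macaulay TYPE('k) k ?\<Delta> \<longleftrightarrow> k \<le> t - s + 2" if bal: "one_balanced P" for k
  proof -
    have \<Delta>: "?\<Delta> = skeleton UNIV (s - 1)" and t: "card (UNIV :: 'v set) = t"
      using one_balanced_skeleton[OF assms(1) bal] assms(2,3) by auto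
    have restr: "restrict_complex ?\<Delta> (UNIV - W) = skeleton (UNIV - W) (s - 1)" for W
      by (simp add: \<Delta> restrict_skeleton)
    have card: "card (UNIV - W) = t - card W" for W :: "'v set"
      using t by (simp add: card_Diff_subset)
    \<comment> \<open>\<open>cdim_skeleton\<close> involves a minimum: the dimension survives a
      deletion exactly as long as \<open>s - 1\<close> vertices remain.\<close>
    have dim: "cdim ?\<Delta> = cdim (restrict_complex ?\<Delta> (UNIV - W)) \<longleftrightarrow> s - 1 \<le> t - card W" for W
      unfolding restr unfolding \<Delta> cdim_skeleton card t using assms(3,4) by auto
    show ?thesis
    proof
      assume "l_cohen_macaulay TYPE('k) k ?\<Delta>"
      then have *: "s - 1 \<le> t - card W" if "card W < k" for W :: "'v set"
        using that dim by (auto simp: l_cohen_macaulay_def)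
      show "k \<le> t - s + 2"
      proof (rule ccontr)
        assume k: "\<not> k \<le> t - s + 2"
        \<comment> \<open>Removing this many vertices leaves only \<open>s - 2\<close>, one too few.
          Such a \<open>W\<close> exists because \<open>2 \<le> s\<close>.\<close>
        have "t - s + 2 \<le> card (UNIV :: 'v set)" using assms(3,4) t by simp
        then obtain W :: "'v set" where "card W = t - s + 2" by (meson obtain_subset_with_card_n)
        then show False using *[of W] k assms(3,4) by simp
      qed
    next
      assume k: "k \<le> t - s + 2"
      have "cohen_macaulay (stanley_reisner_ideal (restrict_complex ?\<Delta> (UNIV - W)) :: ('v, 'k) mpoly set)
          \<and> cdim ?\<Delta> = cdim (restrict_complex ?\<Delta> (UNIV - W))" if "card W < k" for W
      proof -
        have le: "s - 1 \<le> t - card W" using that k assms(3,4) by simp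
        then show ?thesis
          unfolding dim unfolding restr
          by (simp add: stanley_reisner_ideal_eq down_closed_skeleton cohen_macaulay_skeleton card)
      qed
      then show "l_cohen_macaulay TYPE('k) k ?\<Delta>" by (simp add: l_cohen_macaulay_def)
    qed
  qed
  \<comment> \<open>Taking \<open>W = {}\<close> recovers the Cohen-Macaulay property of the edge
    ideal, which forces balancedness. Conversely \<open>s \<le> t\<close> makes \<open>k = 2\<close>
    admissible for every balanced hypergraph.\<close>
  have "l_cohen_macaulay TYPE('k) k ?\<Delta> \<longleftrightarrow> one_balanced P \<and> k \<le> t - s + 2" if "1 \<le> k" for k
    using CM[OF that] balanced iff by blast
  then show ?thesis using assms(5) CM[of 2] balanced iff by auto
qed

end
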